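(* Let $P$ and $Q$ be arbitrary probability distributions on finite sets with $H(Q)>0$. For $0<s_1\le H(P)$, $s_2\in\mathbb R$ and $\nu\in(0,1)$, $$\mathcal R^{2,\mathcal D}_{P,Q}\Big(s_1,\frac{s_1}{H(Q)},\nu\Big)=\mathcal R^{2,\mathcal M}_{P,Q}\Big(s_1,\frac{s_1}{H(Q)},\nu\Big)=\left\{(s_2,t_2)\ \big|\ t_2\le F^{-1}_{P,Q,s_1,s_2}(\nu)\right\}.$$
   Context: All logarithms are to base $2$. $\mathcal P(\mathcal X)$ is the set of probability distributions on a finite set $\mathcal X$; $P^n$ is the $n$-fold i.i.d. product. $H(P)=-\sum_x P(x)\log P(x)$. For a map $f:\mathcal X\to\mathcal Y$, $W_f(P)(y)=\sum_{x\in f^{-1}(y)}P(x)$. Fidelity: $F(Q,Q')=\sum_y\sqrt{Q(y)}\sqrt{Q'(y)}$. $P^{\downarrow}_i$ is the $i$-th largest value of $P$ (and $0$ beyond the size of the set). $P\prec Q$ means $\sum_{i=1}^l P^{\downarrow}_i\le\sum_{i=1}^l Q^{\downarrow}_i$ for all $l$ (the finite sets may differ). A storage of $N$ bits is $K_N=\{0,1\}^N$; for real $N\ge0$ it is a set of $\lfloor 2^N\rfloor$ elements. A real exponent $Q^t$ means $Q^{\lfloor t\rfloor}$. For $P\in\mathcal P(\mathcal X)$, $Q\in\mathcal P(\mathcal Y)$, $F^{\mathcal D}(P\to Q|N)=\sup_{f:\mathcal X\to K_N,\ f':K_N\to\mathcal Y}F(W_{f'}\circ W_f(P),Q)$ and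 $F^{\mathcal M}(P\to Q|N)=\sup\{F(P'',Q)\mid P''\in\mathcal P(\mathcal Y),\ \exists P'\in\mathcal P(K_N):\ P\prec P'\prec P''\}$. For $i\in\{\mathcal D,\mathcal M\}$, $\mathcal R^{2,i}_{P,Q}(s_1,t_1,\nu)$ is the set of $(s_2,t_2)\in\mathbb R^2$ for which there exist $S_n=s_1n+s_2\sqrt n+o(\sqrt n)$ (reals) and $T_n=t_1n+t_2\sqrt n+o(\sqrt n)$ (integers) with $\liminf_{n\to\infty}F^i(P^n\to Q^{T_n}|S_n)\ge\nu$ (only large $n$ matter). Put $F^i_{P,Q,s_1,s_2}(t_2)=\liminf_{n\to\infty}F^i\big(P^n\to Q^{\frac{s_1}{H(Q)}n+t_2\sqrt n}\,\big|\,s_1n+s_2\sqrt n\big)$. $F^{-1}_{P,Q,s_1,s_2}(\nu)$ denotes the generalized inverse $\sup\{t_2\in\mathbb R\mid F^{\mathcal D}_{P,Q,s_1,s_2}(t_2)\ge\nu\}$, which is the ordinary inverse of $F^{\mathcal D}_{P,Q,s_1,s_2}=F^{\mathcal M}_{P,Q,s_1,s_2}$ when this function is continuous and strictly decreasing where it takes values in $(0,1)$. *)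

theory Defs
  imports
    "HOL-Probability.Probability"
    "HOL-Library.Landau_Symbols"
    "HOL-Library.Multiset"
    "HOL-Library.FuncSet"
begin

text \<open>
  A distribution on a finite set \<open>X\<close> is a \<^typ>\<open>'a pmf\<close> whose support is contained in the explicit
  carrier \<open>X\<close>; points of \<open>X\<close> may have probability zero. The \<open>n\<close>-fold i.i.d. product of \<open>P\<close> is
  \<open>replicate_pmf n P\<close>, a distribution on the lists of length \<open>n\<close> over \<open>X\<close>, and the image
  distribution \<open>W_f(P)\<close> is \<open>map_pmf f P\<close>.
\<close>

definition prob_dists :: "'a set \<Rightarrow> 'a pmf set" where
  "prob_dists X = {P. set_pmf P \<subseteq> X}"

definition power_set :: "'a set \<Rightarrow> nat \<Rightarrow> 'a list set" where
  "power_set X n = {xs. set xs \<subseteq> X \<and> length xs = n}"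

text \<open>The convention \<open>0 * log 0 = 0\<close> holds by totality of \<^const>\<open>log\<close>.\<close>

definition shannon_entropy :: "'a set \<Rightarrow> 'a pmf \<Rightarrow> real" where
  "shannon_entropy X P = - (\<Sum>x\<in>X. pmf P x * log 2 (pmf P x))"

definition fidelity :: "'a set \<Rightarrow> 'a pmf \<Rightarrow> 'a pmf \<Rightarrow> real" where
  "fidelity Y Q Q' = (\<Sum>y\<in>Y. sqrt (pmf Q y) * sqrt (pmf Q' y))"

text \<open>
  The values of \<open>P\<close> on \<open>X\<close>, with multiplicity, in decreasing order, continued by zeros. Indices
  start at \<open>0\<close>, so \<open>decr X P i\<close> is the \<open>(i+1)\<close>-th largest value.
\<close>

definition decr :: "'a set \<Rightarrow> 'a pmf \<Rightarrow> nat \<Rightarrow> real" where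
  "decr X P i =
     (let vs = rev (sorted_list_of_multiset (image_mset (pmf P) (mset_set X)))
      in if i < length vs then vs ! i else 0)"

definition majorized :: "'a set \<Rightarrow> 'a pmf \<Rightarrow> 'b set \<Rightarrow> 'b pmf \<Rightarrow> bool" where
  "majorized X P Y Q \<longleftrightarrow> (\<forall>l. (\<Sum>i<l. decr X P i) \<le> (\<Sum>i<l. decr Y Q i))"

text \<open>
  A storage of \<open>N\<close> bits (\<open>N \<ge> 0\<close> real). For negative \<open>N\<close> it is empty and the suprema below are
  unspecified; in the limits this concerns finitely many \<open>n\<close> only, since the leading coefficient
  of the number of bits is positive.
\<close>

definition storage :: "real \<Rightarrow> nat set" where
  "storage N = {..<nat \<lfloor>2 powr N\<rfloor>}"

definition fid_det :: "'a set \<Rightarrow> 'a pmf \<Rightarrow> 'b set \<Rightarrow> 'b pmf \<Rightarrow> real \<Rightarrow> real" where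
  "fid_det X P Y Q N =
     Sup {fidelity Y (map_pmf f' (map_pmf f P)) Q | f f'. f \<in> X \<rightarrow> storage N \<and> f' \<in> storage N \<rightarrow> Y}"

definition fid_maj :: "'a set \<Rightarrow> 'a pmf \<Rightarrow> 'b set \<Rightarrow> 'b pmf \<Rightarrow> real \<Rightarrow> real" where
  "fid_maj X P Y Q N =
     Sup {fidelity Y P'' Q | P''. P'' \<in> prob_dists Y \<and>
            (\<exists>P'\<in>prob_dists (storage N).
               majorized X P (storage N) P' \<and> majorized (storage N) P' Y P'')}"

text \<open>
  The notions below are parametrised by the fidelity functional \<open>F\<close>, to be instantiated with
  \<^const>\<open>fid_det\<close> or \<^const>\<open>fid_maj\<close>.
\<close>

type_synonym ('a, 'b) fid_functional =
  "'a list set \<Rightarrow> 'a list pmf \<Rightarrow> 'b list set \<Rightarrow> 'b list pmf \<Rightarrow> real \<Rightarrow> real"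

definition iid_fid ::
  "('a, 'b) fid_functional \<Rightarrow> 'a set \<Rightarrow> 'a pmf \<Rightarrow> 'b set \<Rightarrow> 'b pmf \<Rightarrow> nat \<Rightarrow> int \<Rightarrow> real \<Rightarrow> real" where
  "iid_fid F X P Y Q n m N =
     F (power_set X n) (replicate_pmf n P) (power_set Y (nat m)) (replicate_pmf (nat m) Q) N"

definition rate_region2 ::
  "('a, 'b) fid_functional \<Rightarrow> 'a set \<Rightarrow> 'a pmf \<Rightarrow> 'b set \<Rightarrow> 'b pmf \<Rightarrow>
   real \<Rightarrow> real \<Rightarrow> real \<Rightarrow> (real \<times> real) set" where
  "rate_region2 F X P Y Q s1 t1 \<nu> =
     {(s2, t2). \<exists>(S :: nat \<Rightarrow> real) (T :: nat \<Rightarrow> int).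
        (\<lambda>n. S n - (s1 * real n + s2 * sqrt (real n))) \<in> o(\<lambda>n. sqrt (real n)) \<and>
        (\<lambda>n. real_of_int (T n) - (t1 * real n + t2 * sqrt (real n))) \<in> o(\<lambda>n. sqrt (real n)) \<and>
        liminf (\<lambda>n. ereal (iid_fid F X P Y Q n (T n) (S n))) \<ge> ereal \<nu>}"

definition lim_fid ::
  "('a, 'b) fid_functional \<Rightarrow> 'a set \<Rightarrow> 'a pmf \<Rightarrow> 'b set \<Rightarrow> 'b pmf \<Rightarrow>
   real \<Rightarrow> real \<Rightarrow> real \<Rightarrow> ereal" where
  "lim_fid F X P Y Q s1 s2 t2 =
     liminf (\<lambda>n. ereal (iid_fid F X P Y Q n
       \<lfloor>s1 / shannon_entropy Y Q * real n + t2 * sqrt (real n)\<rfloor>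
       (s1 * real n + s2 * sqrt (real n))))"

text \<open>
  The supremum is taken in the extended reals, so that it is meaningful without a prior proof
  that the set is nonempty and bounded above.
\<close>

definition lim_fid_inv ::
  "'a set \<Rightarrow> 'a pmf \<Rightarrow> 'b set \<Rightarrow> 'b pmf \<Rightarrow> real \<Rightarrow> real \<Rightarrow> real \<Rightarrow> ereal" where
  "lim_fid_inv X P Y Q s1 s2 \<nu> =
     Sup (ereal ` {t2 :: real. lim_fid fid_det X P Y Q s1 s2 t2 \<ge> ereal \<nu>})"

end

theory Submission
  imports Defs "HOL-Real_Asymp.Real_Asymp"
begin

text \<open>
  No second-order asymptotics of the fidelity are computed. A deterministic conversion induces a
  majorization chain, so deterministic fidelity never exceeds majorization fidelity. Conversely,
  let \<open>P\<^sup>n \<prec> P' \<prec> R\<close> with \<open>R\<close> on \<open>Y\<^sup>T\<^sup>'\<close>, and let \<open>T' - T \<ge> \<delta> \<surd>n\<close>. The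
  atoms of the \<open>T' - T\<close> surplus copies of \<open>Q\<close> are exponentially small in \<open>\<surd>n\<close> (as \<open>H(Q) > 0\<close>), so
  \<open>R\<close> can have a substantial fidelity only if it is spread out over the fibres of the projection
  to \<open>Y\<^sup>T\<close>. Hence few points of \<open>Y\<^sup>T\<close> matter, which absorbs a change of \<open>o(\<surd>n)\<close> bits of storage,
  and each of them receives so many atoms of \<open>P\<^sup>n\<close> that the random assignment can be replaced by
  a deterministic one. Thus the two regions agree up to an arbitrarily small decrease of \<open>t\<^sub>2\<close>,
  and a diagonal choice of \<open>T\<^sub>n\<close> reaches the supremum.
\<close>

section \<open>Majorization and couplings\<close>

text \<open>Cauchy-Schwarz, in the form that bounds fidelities by masses.\<close>

lemma sum_sqrt_mult_le:
  fixes f g :: "'i \<Rightarrow> real"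
  assumes "\<And>i. i \<in> I \<Longrightarrow> 0 \<le> f i" and "\<And>i. i \<in> I \<Longrightarrow> 0 \<le> g i"
  shows "(\<Sum>i\<in>I. sqrt (f i) * sqrt (g i)) \<le> sqrt (sum f I) * sqrt (sum g I)"
proof -
  have "(\<Sum>i\<in>I. sqrt (f i) * sqrt (g i)) = (\<Sum>i\<in>I. \<bar>sqrt (f i)\<bar> * \<bar>sqrt (g i)\<bar>)"
    using assms by (intro sum.cong) auto
  also have "\<dots> \<le> L2_set (\<lambda>i. sqrt (f i)) I * L2_set (\<lambda>i. sqrt (g i)) I"
    by (rule L2_set_mult_ineq)
  also have "\<dots> = sqrt (sum f I) * sqrt (sum g I)"
    unfolding L2_set_def using assms by (intro arg_cong2[where f = "(*)"] arg_cong[where f = sqrt] sum.cong) auto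
  finally show ?thesis .
qed

lemma sum_pmf_le_1: "finite A \<Longrightarrow> sum (pmf P) A \<le> 1"
  by (metis measure_measure_pmf_finite measure_pmf.prob_le_1)

lemma sum_pmf_carrier: "finite X \<Longrightarrow> P \<in> prob_dists X \<Longrightarrow> sum (pmf P) X = 1"
  by (auto simp: prob_dists_def intro: sum_pmf_eq_1)

lemma carrier_nonempty: "P \<in> prob_dists X \<Longrightarrow> X \<noteq> {}"
  using set_pmf_not_empty[of P] by (auto simp: prob_dists_def)

lemma fidelity_nonneg: "0 \<le> fidelity Y Q Q'"
  by (auto simp: fidelity_def intro!: sum_nonneg)

lemma fidelity_le_1:
  assumes "finite Y"
  shows "fidelity Y Q Q' \<le> 1"
proof -
  have "fidelity Y Q Q' \<le> sqrt (sum (pmf Q) Y) * sqrt (sum (pmf Q') Y)"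
    unfolding fidelity_def by (rule sum_sqrt_mult_le) auto
  also have "\<dots> \<le> 1 * 1"
    using sum_pmf_le_1[OF assms] by (intro mult_mono) (auto intro: sum_nonneg)
  finally show ?thesis by simp
qed

text \<open>Sorting the points of \<open>X\<close> by mass, instead of the multiset of values, turns
  sums of \<open>decr\<close> into sums over points.\<close>

lemma decr_enumeration:
  assumes "finite X"
  obtains e where "bij_betw e {..<card X} X"
    and "\<And>i. i < card X \<Longrightarrow> decr X P i = pmf P (e i)"
    and "\<And>i. card X \<le> i \<Longrightarrow> decr X P i = 0"
proof -
  obtain ys where ys: "set ys = X" "distinct ys"
    using finite_distinct_list[OF assms] by blast
  define xs where "xs = rev (sort_key (pmf P) ys)"
  have len: "length xs = card X"
    using ys distinct_card[of ys] by (simp add: xs_def)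
  have "image_mset (pmf P) (mset_set X) = mset (map (pmf P) ys)"
    using ys mset_set_set[of ys] by simp
  moreover have "sort (map (pmf P) ys) = map (pmf P) (sort_key (pmf P) ys)"
    by (rule properties_for_sort) simp_all
  ultimately have vs: "rev (sorted_list_of_multiset (image_mset (pmf P) (mset_set X))) = map (pmf P) xs"
    by (simp only: sorted_list_of_multiset_mset xs_def rev_map)
  show thesis
  proof
    have "distinct xs" "set xs = X"
      using ys by (auto simp: xs_def)
    then show "bij_betw (\<lambda>i. xs ! i) {..<card X} X"
      using bij_betw_nth len by metis
  qed (auto simp: decr_def vs len)
qed

lemma decr_nonneg: "finite X \<Longrightarrow> 0 \<le> decr X P i"
  by (rule decr_enumeration[of X P], assumption) (cases "i < card X"; simp)

lemma decr_antimono: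
  assumes "finite X" "i \<le> j"
  shows "decr X P j \<le> decr X P i"
proof -
  let ?l = "sorted_list_of_multiset (image_mset (pmf P) (mset_set X))"
  show ?thesis
  proof (cases "j < length ?l")
    case True
    have "sorted ?l" by (rule sorted_sorted_list_of_multiset)
    then have "rev ?l ! j \<le> rev ?l ! i"
      using True assms by (simp add: rev_nth sorted_nth_mono)
    then show ?thesis using True assms by (simp add: decr_def Let_def)
  next
    case False
    then have "decr X P j = 0" by (simp add: decr_def Let_def)
    then show ?thesis using decr_nonneg[OF assms(1)] by simp
  qed
qed

text \<open>The maximum of \<open>I\<close> is at least \<open>card I - 1\<close>, so its summand is
  at most the last one of the initial segment; remove it and induct.\<close>

lemma sum_antimono_le_initial:
  fixes d :: "nat \<Rightarrow> real"
  assumes "antimono d" "finite I"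
  shows "sum d I \<le> sum d {..<card I}"
  using assms(2)
proof (induction "card I" arbitrary: I)
  case (Suc k)
  then have ne: "I \<noteq> {}" by auto
  define m where "m = Max I"
  have m: "m \<in> I" using ne Suc m_def by auto
  have "I \<subseteq> {..m}" using Suc m_def by auto
  then have "card I \<le> Suc m" using card_mono[of "{..m}" I] by simp
  then have "d m \<le> d k" using assms(1) Suc(2) by (auto simp: antimono_def)
  moreover have "sum d (I - {m}) \<le> sum d {..<k}"
    using Suc.hyps(1)[of "I - {m}"] Suc(2)[symmetric] Suc(3) m by simp
  ultimately show ?case
    using Suc(2)[symmetric] sum.remove[OF Suc(3) m, of d] by simp
qed simp

text \<open>Together with \<open>sum_decr_attained\<close>, this identifies the partial sums of
  \<open>decr\<close> with the maximal mass of a set of at most \<open>l\<close> points, so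
  majorization can be checked on sets.\<close>

lemma sum_pmf_le_sum_decr:
  assumes "finite X" "A \<subseteq> X" "card A \<le> l"
  shows "sum (pmf P) A \<le> (\<Sum>i<l. decr X P i)"
proof -
  obtain e where e: "bij_betw e {..<card X} X" "\<And>i. i < card X \<Longrightarrow> decr X P i = pmf P (e i)"
    using decr_enumeration[OF assms(1)] by metis
  define I where "I = {i. i < card X \<and> e i \<in> A}"
  have fin: "finite I" by (simp add: I_def)
  have inj: "inj_on e I"
    using e(1) by (auto simp: I_def bij_betw_def inj_on_def)
  have im: "e ` I = A"
  proof
    show "A \<subseteq> e ` I"
    proof
      fix x assume x: "x \<in> A"
      then have "x \<in> e ` {..<card X}" using e(1) assms(2) by (auto simp: bij_betw_def)
      then show "x \<in> e ` I" using x by (auto simp: I_def)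
    qed
  qed (auto simp: I_def)
  have "sum (pmf P) A = sum (decr X P) I"
    unfolding im[symmetric] sum.reindex[OF inj] using e(2) by (intro sum.cong) (auto simp: I_def)
  also have "\<dots> \<le> sum (decr X P) {..<card I}"
    using decr_antimono[OF assms(1)] fin by (intro sum_antimono_le_initial) (auto simp: antimono_def)
  also have "\<dots> \<le> (\<Sum>i<l. decr X P i)"
    using card_image[OF inj] im assms(3) decr_nonneg[OF assms(1)] by (intro sum_mono2) auto
  finally show ?thesis .
qed

lemma sum_decr_attained:
  assumes "finite X"
  obtains A where "A \<subseteq> X" "card A \<le> l" "(\<Sum>i<l. decr X P i) = sum (pmf P) A"
proof -
  obtain e where e: "bij_betw e {..<card X} X" "\<And>i. i < card X \<Longrightarrow> decr X P i = pmf P (e i)"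
     "\<And>i. card X \<le> i \<Longrightarrow> decr X P i = 0"
    using decr_enumeration[OF assms(1)] by metis
  define I where "I = {..<min l (card X)}"
  have inj: "inj_on e I"
    using e(1) by (auto simp: I_def bij_betw_def inj_on_def)
  show thesis
  proof
    show "e ` I \<subseteq> X" using e(1) by (auto simp: I_def bij_betw_def)
    show "card (e ` I) \<le> l" using card_image[OF inj] by (simp add: I_def)
    have "(\<Sum>i<l. decr X P i) = sum (decr X P) I"
      using e(3) by (intro sum.mono_neutral_right) (auto simp: I_def)
    then show "(\<Sum>i<l. decr X P i) = sum (pmf P) (e ` I)"
      using inj e(2) by (simp add: sum.reindex I_def)
  qed
qed

lemma sum_decr_le_1: "finite X \<Longrightarrow> (\<Sum>i<l. decr X P i) \<le> 1"
  by (rule sum_decr_attained[of X l P], assumption) (simp add: finite_subset sum_pmf_le_1)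

lemma sum_decr_eq_1:
  assumes "finite X" "P \<in> prob_dists X" "card X \<le> l"
  shows "(\<Sum>i<l. decr X P i) = 1"
  using sum_pmf_le_sum_decr[OF assms(1) order_refl assms(3), of P] sum_pmf_carrier[OF assms(1,2)]
    sum_decr_le_1[OF assms(1), of P l] by simp

section \<open>Image distributions and their majorization\<close>

lemma pmf_map_sum:
  assumes "finite X" "P \<in> prob_dists X"
  shows "pmf (map_pmf f P) y = (\<Sum>x | x \<in> X \<and> f x = y. pmf P x)"
proof -
  have "pmf (map_pmf f P) y = measure P (f -` {y} \<inter> set_pmf P)"
    by (simp add: pmf_map measure_Int_set_pmf)
  also have "f -` {y} \<inter> set_pmf P = {x \<in> X. f x = y} \<inter> set_pmf P"
    using assms(2) by (auto simp: prob_dists_def)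
  also have "measure P \<dots> = sum (pmf P) {x \<in> X. f x = y}"
    using assms(1) by (simp add: measure_Int_set_pmf measure_measure_pmf_finite)
  finally show ?thesis by simp
qed

lemma map_pmf_prob_dists: "P \<in> prob_dists X \<Longrightarrow> f \<in> X \<rightarrow> Y \<Longrightarrow> map_pmf f P \<in> prob_dists Y"
  by (auto simp: prob_dists_def)

text \<open>An optimal set \<open>A\<close> for \<open>P\<close> has an image with no more points,
  and the preimage of that image contains \<open>A\<close>.\<close>

lemma majorized_map:
  assumes X: "finite X" and Y: "finite Y" and f: "f \<in> X \<rightarrow> Y" and P: "P \<in> prob_dists X"
  shows "majorized X P Y (map_pmf f P)"
  unfolding majorized_def
proof
  fix l
  obtain A where A: "A \<subseteq> X" "card A \<le> l" "(\<Sum>i<l. decr X P i) = sum (pmf P) A"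
    using sum_decr_attained[OF X] .
  have fin: "finite A" using A X finite_subset by blast
  have "sum (pmf P) A = measure P A" using fin by (simp add: measure_measure_pmf_finite)
  also have "\<dots> \<le> measure P (f -` f ` A)"
    by (intro measure_pmf.finite_measure_mono) auto
  also have "\<dots> = sum (pmf (map_pmf f P)) (f ` A)"
    using fin by (simp add: measure_measure_pmf_finite[symmetric])
  also have "\<dots> \<le> (\<Sum>i<l. decr Y (map_pmf f P) i)"
    using A f card_image_le[OF fin, of f] by (intro sum_pmf_le_sum_decr Y) auto
  finally show "(\<Sum>i<l. decr X P i) \<le> (\<Sum>i<l. decr Y (map_pmf f P) i)"
    using A by simp
qed

lemma majorized_trans: "majorized X P Y Q \<Longrightarrow> majorized Y Q Z R \<Longrightarrow> majorized X P Z R"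
  unfolding majorized_def by (meson order_trans)

text \<open>At \<open>l = card K\<close> the partial sum of \<open>P\<close> is already 1, hence
  \<open>card K\<close> points carry all of \<open>R\<close>. This is how the size of the storage
  constrains the output.\<close>

lemma majorized_card_support:
  assumes K: "finite K" "P \<in> prob_dists K" and B: "finite B" "R \<in> prob_dists B"
    and "majorized K P B R"
  shows "card (set_pmf R) \<le> card K"
proof -
  obtain A where A: "A \<subseteq> B" "card A \<le> card K" "(\<Sum>i<card K. decr B R i) = sum (pmf R) A"
    using sum_decr_attained[OF B(1)] .
  have fin: "finite A" using A B finite_subset by blast
  have "1 \<le> sum (pmf R) A"
    using assms(5) sum_decr_eq_1[OF K] A(3) by (metis majorized_def order_refl)
  then have "measure R A = 1"
    using sum_pmf_le_1[OF fin, of R] by (simp add: measure_measure_pmf_finite fin)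
  then have "set_pmf R \<subseteq> A"
    using measure_pmf.prob_eq_1[of A R] by (auto simp: AE_measure_pmf_iff)
  then have "card (set_pmf R) \<le> card A" by (rule card_mono[OF fin])
  then show ?thesis using A(2) by simp
qed

text \<open>
  Laying out the atoms of both distributions in decreasing order as consecutive intervals of
  \<open>[0, 1]\<close>, \<open>J x b\<close> is the length of the overlap. Majorization makes the \<open>i\<close>-th interval of \<open>R\<close>
  meet only intervals of \<open>P\<close> of index at least \<open>i\<close>, whose lengths are at most the \<open>i\<close>-th largest
  value of \<open>P\<close>; this value is \<open>\<pi> b\<close>.
\<close>

lemma majorized_coupling:
  assumes X: "finite X" "P \<in> prob_dists X" and B: "finite B" "R \<in> prob_dists B"
    and maj: "majorized X P B R"
  obtains J :: "'a \<Rightarrow> 'b \<Rightarrow> real" and \<pi> :: "'b \<Rightarrow> real"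
  where "\<And>x b. 0 \<le> J x b" and "\<And>x. x \<in> X \<Longrightarrow> (\<Sum>b\<in>B. J x b) = pmf P x"
    and "\<And>b. b \<in> B \<Longrightarrow> (\<Sum>x\<in>X. J x b) = pmf R b"
    and "\<And>b. 0 \<le> \<pi> b" and "sum \<pi> B \<le> 1"
    and "\<And>x b. x \<in> X \<Longrightarrow> b \<in> B \<Longrightarrow> 0 < J x b \<Longrightarrow> pmf P x \<le> \<pi> b"
proof -
  obtain e where e: "bij_betw e {..<card X} X" "\<And>i. i < card X \<Longrightarrow> decr X P i = pmf P (e i)"
    using decr_enumeration[OF X(1)] by metis
  obtain e' where e': "bij_betw e' {..<card B} B" "\<And>i. i < card B \<Longrightarrow> decr B R i = pmf R (e' i)"
    using decr_enumeration[OF B(1)] by metis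
  define C where "C l = (\<Sum>i<l. decr X P i)" for l
  define D where "D l = (\<Sum>i<l. decr B R i)" for l
  have C01: "C 0 = 0" "C (card X) = 1" and D01: "D 0 = 0" "D (card B) = 1"
    using sum_decr_eq_1[OF X] sum_decr_eq_1[OF B] by (simp_all add: C_def D_def)
  have Cle: "0 \<le> C l" "C l \<le> 1" and Dle: "0 \<le> D l" "D l \<le> 1" for l
    using sum_decr_le_1 X B decr_nonneg by (auto simp: C_def D_def intro!: sum_nonneg)
  have CD: "C l \<le> D l" for l using maj by (simp add: majorized_def C_def D_def)
  have Cs: "C (Suc l) = C l + decr X P l" and Ds: "D (Suc l) = D l + decr B R l" for l
    by (simp_all add: C_def D_def)
  have Cm: "C l \<le> C (Suc l)" and Dm: "D l \<le> D (Suc l)" for l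
    using decr_nonneg[OF X(1)] decr_nonneg[OF B(1)] by (auto simp: Cs Ds)
  have Cmono: "i \<le> j \<Longrightarrow> C i \<le> C j" for i j using Cm by (rule lift_Suc_mono_le)
  define L where "L j i = max 0 (min (C (Suc j)) (D (Suc i)) - max (C j) (D i))" for j i
  \<comment> \<open>The overlap is a difference of endpoints of one interval clamped to the other.
    \<open>L1\<close> telescopes in \<open>j\<close> and \<open>L2\<close> in \<open>i\<close>,
    which yields the two marginals.\<close>
  have L1: "L j i = max (D i) (min (C (Suc j)) (D (Suc i))) - max (D i) (min (C j) (D (Suc i)))" for j i
    using Cm[of j] Dm[of i] by (auto simp: L_def max_def min_def)
  have L2: "L j i = max (C j) (min (D (Suc i)) (C (Suc j))) - max (C j) (min (D i) (C (Suc j)))" for j i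
    using Cm[of j] Dm[of i] by (auto simp: L_def max_def min_def)
  have S1: "(\<Sum>j<card X. L j i) = decr B R i" for i
    unfolding L1 using sum_lessThan_telescope[of "\<lambda>j. max (D i) (min (C j) (D (Suc i)))" "card X"]
      C01 Dle[of i] Dle[of "Suc i"] Dm[of i] Ds[of i] by (auto simp: max_def min_def)
  have S2: "(\<Sum>i<card B. L j i) = decr X P j" for j
    unfolding L2 using sum_lessThan_telescope[of "\<lambda>i. max (C j) (min (D i) (C (Suc j)))" "card B"]
      D01 Cle[of j] Cle[of "Suc j"] Cm[of j] Cs[of j] by (auto simp: max_def min_def)
  have L3: "decr X P j \<le> decr X P i" if "0 < L j i" for j i
  proof -
    have "D i < C (Suc j)" using that by (auto simp: L_def)
    then have "C i < C (Suc j)" using CD[of i] by simp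
    then have "i \<le> j" using Cmono[of "Suc j" i] by (meson linorder_not_le not_less_eq_eq)
    then show ?thesis by (rule decr_antimono[OF X(1)])
  qed
  define u where "u = inv_into {..<card X} e"
  define v where "v = inv_into {..<card B} e'"
  have u: "bij_betw u X {..<card X}" and v: "bij_betw v B {..<card B}"
    unfolding u_def v_def using e e' by (auto intro: bij_betw_inv_into)
  have pu: "decr X P (u x) = pmf P x" "u x < card X" if "x \<in> X" for x
  proof -
    show "u x < card X" using u that by (auto simp: bij_betw_def)
    then show "decr X P (u x) = pmf P x"
      using e(2) bij_betw_inv_into_right[OF e(1) that] by (simp add: u_def)
  qed
  have pv: "decr B R (v x) = pmf R x" "v x < card B" if "x \<in> B" for x
  proof -
    show "v x < card B" using v that by (auto simp: bij_betw_def)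
    then show "decr B R (v x) = pmf R x"
      using e'(2) bij_betw_inv_into_right[OF e'(1) that] by (simp add: v_def)
  qed
  show thesis
  proof
    show "0 \<le> L (u x) (v b)" for x b by (simp add: L_def)
    show "(\<Sum>b\<in>B. L (u x) (v b)) = pmf P x" if "x \<in> X" for x
      using sum.reindex_bij_betw[OF v, of "L (u x)"] S2 pu that by simp
    show "(\<Sum>x\<in>X. L (u x) (v b)) = pmf R b" if "b \<in> B" for b
      using sum.reindex_bij_betw[OF u, of "\<lambda>j. L j (v b)"] S1 pv that by simp
    show "0 \<le> decr X P (v b)" for b by (rule decr_nonneg[OF X(1)])
    show "(\<Sum>b\<in>B. decr X P (v b)) \<le> 1"
      using sum.reindex_bij_betw[OF v, of "decr X P"] Cle(2)[of "card B"] by (simp add: C_def)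
    show "pmf P x \<le> decr X P (v b)" if "x \<in> X" "b \<in> B" "0 < L (u x) (v b)" for x b
      using L3[OF that(3)] pu that by simp
  qed
qed

section \<open>Deterministic conversion\<close>

text \<open>
  The method of conditional expectations: \<open>x\<close> is sent to \<open>y\<close> with probability \<open>\<mu> x y / p x\<close>, and the
  right-hand side is the expectation of the left-hand side up to dropping negative covariances.
\<close>

lemma derandomized_assignment:
  fixes p :: "'x \<Rightarrow> real" and \<mu> :: "'x \<Rightarrow> 'y \<Rightarrow> real" and \<alpha> \<beta> c :: "'y \<Rightarrow> real"
  assumes "finite X" and E: "finite E" and "\<And>x. x \<in> X \<Longrightarrow> 0 \<le> p x"
    and "\<And>x y. x \<in> X \<Longrightarrow> y \<in> E \<Longrightarrow> 0 \<le> \<mu> x y" and "\<And>x. x \<in> X \<Longrightarrow> sum (\<mu> x) E \<le> p x"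
    and \<beta>: "\<And>y. y \<in> E \<Longrightarrow> 0 \<le> \<beta> y"
  shows "\<exists>g :: 'x \<Rightarrow> 'y option. (\<forall>x\<in>X. g x \<in> insert None (Some ` E)) \<and>
    (\<Sum>y\<in>E. \<alpha> y * (c y + (\<Sum>x\<in>X. \<mu> x y))
          - \<beta> y * ((c y + (\<Sum>x\<in>X. \<mu> x y))\<^sup>2 + (\<Sum>x\<in>X. p x * \<mu> x y)))
    \<le> (\<Sum>y\<in>E. \<alpha> y * (c y + (\<Sum>x | x \<in> X \<and> g x = Some y. p x))
          - \<beta> y * (c y + (\<Sum>x | x \<in> X \<and> g x = Some y. p x))\<^sup>2)"
  using assms(1,3-5)
proof (induction X arbitrary: c rule: finite_induct)
  case empty
  then show ?case by simp
next
  case (insert a F)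
  define M where "M y = (\<Sum>x\<in>F. \<mu> x y)" for y
  define N where "N y = (\<Sum>x\<in>F. p x * \<mu> x y)" for y
  \<comment> \<open>\<open>V d\<close> is the estimator once the points treated so far have
    contributed \<open>d\<close> and those of \<open>F\<close> are still random.\<close>
  define V where "V d = (\<Sum>y\<in>E. \<alpha> y * (d y + M y) - \<beta> y * ((d y + M y)\<^sup>2 + N y))" for d
  define t where "t y = \<mu> a y / p a" for y
  have pa: "0 \<le> p a" and \<mu>a: "\<And>y. y \<in> E \<Longrightarrow> 0 \<le> \<mu> a y" and \<mu>s: "sum (\<mu> a) E \<le> p a"
    using insert.prems by auto
  have t0: "0 \<le> t y" if "y \<in> E" for y using pa \<mu>a that by (simp add: t_def)
  have ts: "sum t E \<le> 1"
    using pa \<mu>s by (cases "p a = 0") (auto simp: t_def sum_divide_distrib[symmetric] divide_le_eq)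
  \<comment> \<open>If \<open>p a = 0\<close> the quotient \<open>t y\<close> is 0 by convention,
    and the bound on the sum forces \<open>\<mu> a y = 0\<close> as well.\<close>
  have \<mu>t: "\<mu> a y = p a * t y" if "y \<in> E" for y
  proof (cases "p a = 0")
    case True
    then have "sum (\<mu> a) E = 0" using \<mu>s \<mu>a by (simp add: sum_nonneg order_antisym)
    then have "\<mu> a y = 0" using sum_nonneg_eq_0_iff[OF E] \<mu>a that by blast
    then show ?thesis using True by simp
  qed (simp add: t_def)
  \<comment> \<open>\<open>k y\<close> is the change of the estimator when \<open>a\<close> is put
    on \<open>y\<close>, and \<open>s\<close> is the mean change under the random choice.\<close>
  define k where "k y = \<alpha> y * p a - \<beta> y * (2 * (c y + M y) * p a + (p a)\<^sup>2)" for y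
  define s where "s = (\<Sum>y\<in>E. t y * k y)"
  have "(\<Sum>y\<in>E. \<alpha> y * (c y + (\<Sum>x\<in>insert a F. \<mu> x y))
          - \<beta> y * ((c y + (\<Sum>x\<in>insert a F. \<mu> x y))\<^sup>2 + (\<Sum>x\<in>insert a F. p x * \<mu> x y)))
      \<le> (\<Sum>y\<in>E. (\<alpha> y * (c y + M y) - \<beta> y * ((c y + M y)\<^sup>2 + N y)) + t y * k y)"
  proof (rule sum_mono)
    fix y assume y: "y \<in> E"
    \<comment> \<open>The only loss of the induction step: the squared mean contribution of
      \<open>a\<close>, which the exact second moment does not contain.\<close>
    have "0 \<le> \<beta> y * (p a * t y)\<^sup>2" using \<beta>[OF y] by simp
    moreover have "(\<alpha> y * (c y + M y) - \<beta> y * ((c y + M y)\<^sup>2 + N y)) + t y * k y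
        - (\<alpha> y * (c y + (p a * t y + M y)) - \<beta> y * ((c y + (p a * t y + M y))\<^sup>2 + (p a * (p a * t y) + N y)))
        = \<beta> y * (p a * t y)\<^sup>2"
      unfolding k_def by algebra
    ultimately show "\<alpha> y * (c y + (\<Sum>x\<in>insert a F. \<mu> x y))
          - \<beta> y * ((c y + (\<Sum>x\<in>insert a F. \<mu> x y))\<^sup>2 + (\<Sum>x\<in>insert a F. p x * \<mu> x y))
      \<le> (\<alpha> y * (c y + M y) - \<beta> y * ((c y + M y)\<^sup>2 + N y)) + t y * k y"
      using insert.hyps \<mu>t[OF y] by (simp add: M_def[symmetric] N_def[symmetric])
  qed
  also have "\<dots> = V c + s" by (simp add: V_def s_def sum.distrib)
  finally have le: "(\<Sum>y\<in>E. \<alpha> y * (c y + (\<Sum>x\<in>insert a F. \<mu> x y))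
          - \<beta> y * ((c y + (\<Sum>x\<in>insert a F. \<mu> x y))\<^sup>2 + (\<Sum>x\<in>insert a F. p x * \<mu> x y))) \<le> V c + s" .
  \<comment> \<open>The probabilities \<open>t\<close> sum to at most 1 and the rest belongs to
    \<open>None\<close>, whose change is 0. Hence \<open>None\<close> attains the mean if
    \<open>s \<le> 0\<close>, and otherwise a maximizer of \<open>k\<close> does.\<close>
  obtain z where z: "z \<in> insert None (Some ` E)"
    and zV: "V c + s \<le> V (\<lambda>y. c y + (if z = Some y then p a else 0))"
  proof (cases "s \<le> 0")
    case True
    then show thesis using that[of None] by simp
  next
    case False
    then have ne: "E \<noteq> {}" by (auto simp: s_def)
    then obtain y0 where y0: "y0 \<in> E" "k y0 = Max (k ` E)"
      using E Max_in[of "k ` E"] by fastforce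
    have kle: "k y \<le> k y0" if "y \<in> E" for y using y0 E that by simp
    have "s \<le> (\<Sum>y\<in>E. t y * k y0)"
      unfolding s_def using t0 kle by (intro sum_mono mult_left_mono) auto
    also have "\<dots> = sum t E * k y0" by (simp add: sum_distrib_right)
    finally have 1: "s \<le> sum t E * k y0" .
    have t0s: "0 \<le> sum t E" using t0 by (intro sum_nonneg)
    have "0 < k y0"
    proof (rule ccontr)
      assume "\<not> 0 < k y0"
      then have "sum t E * k y0 \<le> 0" using t0s by (intro mult_nonneg_nonpos) auto
      then show False using 1 False by simp
    qed
    then have "sum t E * k y0 \<le> 1 * k y0" using ts by (intro mult_right_mono) auto
    then have "s \<le> k y0" using 1 by simp
    moreover have "V (\<lambda>y. c y + (if Some y0 = Some y then p a else 0)) = V c + k y0"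
    proof -
      have "V (\<lambda>y. c y + (if Some y0 = Some y then p a else 0))
          = (\<Sum>y\<in>E. (\<alpha> y * (c y + M y) - \<beta> y * ((c y + M y)\<^sup>2 + N y)) + (if y = y0 then k y else 0))"
        unfolding V_def k_def
        by (intro sum.cong) (auto simp: algebra_simps power2_eq_square)
      then show ?thesis using E y0 by (simp add: V_def sum.distrib)
    qed
    ultimately show thesis using that[of "Some y0"] y0 by simp
  qed
  define d where "d y = c y + (if z = Some y then p a else 0)" for y
  obtain g where g: "\<forall>x\<in>F. g x \<in> insert None (Some ` E)"
    and gV: "V d \<le> (\<Sum>y\<in>E. \<alpha> y * (d y + (\<Sum>x | x \<in> F \<and> g x = Some y. p x))
          - \<beta> y * (d y + (\<Sum>x | x \<in> F \<and> g x = Some y. p x))\<^sup>2)"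
    using insert.IH[of d] insert.prems unfolding V_def M_def N_def by auto
  define g' where "g' = g(a := z)"
  have eq: "c y + (\<Sum>x | x \<in> insert a F \<and> g' x = Some y. p x)
      = d y + (\<Sum>x | x \<in> F \<and> g x = Some y. p x)" for y
  proof -
    have "{x. x \<in> insert a F \<and> g' x = Some y}
        = (if z = Some y then insert a {x. x \<in> F \<and> g x = Some y} else {x. x \<in> F \<and> g x = Some y})"
      using insert.hyps by (auto simp: g'_def)
    then show ?thesis using insert.hyps by (simp add: d_def)
  qed
  have "V c + s \<le> V d" using zV unfolding d_def .
  then show ?case
    using g z le gV unfolding eq[symmetric]
    by (intro exI[of _ g'] conjI) (simp add: g'_def, linarith)
qed

text \<open>A quadratic minorant of the square root that vanishes at 0 and is tangent at
  \<open>z = c\<close>. Being quadratic, it can be fed to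
  \<open>derandomized_assignment\<close>.\<close>

lemma sqrt_ge_quadratic:
  fixes z c :: real
  assumes "0 \<le> z" "0 < c"
  shows "sqrt c * (3 * (z / c) - (z / c)\<^sup>2) / 2 \<le> sqrt z"
proof -
  define v where "v = sqrt (z / c)"
  have v: "0 \<le> v" "v\<^sup>2 = z / c" using assms by (simp_all add: v_def)
  \<comment> \<open>With \<open>v = sqrt (z / c)\<close> the gap factors with a double zero at the
    point of tangency \<open>v = 1\<close>.\<close>
  have "0 \<le> v * ((v - 1)\<^sup>2 * (v + 2))" using v(1) by (intro mult_nonneg_nonneg) auto
  also have "\<dots> = 2 * v - (3 * v\<^sup>2 - (v\<^sup>2)\<^sup>2)" by algebra
  finally have "(3 * (z / c) - (z / c)\<^sup>2) / 2 \<le> v" by (simp add: v)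
  then have "sqrt c * ((3 * (z / c) - (z / c)\<^sup>2) / 2) \<le> sqrt c * v"
    using assms by (intro mult_left_mono) auto
  also have "sqrt c * v = sqrt z" using assms by (simp add: v_def real_sqrt_divide)
  finally show ?thesis by simp
qed

text \<open>
  \<open>B\<close> plays the role of \<open>A \<times> Z\<close> with projection \<open>h\<close>, and \<open>QB\<close> that of \<open>QA \<otimes> w\<close>. If all
  values of \<open>w\<close> are small, a fibre contributes to the fidelity only when \<open>R\<close> spreads over many
  of its points; this leaves few relevant fibres, each of a mass exceeding by far the atoms of \<open>P\<close>
  that have to be placed there.
\<close>

locale fibred_target =
  fixes A :: "'a set" and B :: "'b set" and R QB :: "'b pmf" and QA :: "'a pmf"
    and h :: "'b \<Rightarrow> 'a" and w :: "'b \<Rightarrow> real" and \<eta> \<kappa> :: real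
  assumes A: "finite A" and B: "finite B" "R \<in> prob_dists B"
    and h: "h \<in> B \<rightarrow> A" and QB: "\<And>b. b \<in> B \<Longrightarrow> pmf QB b = pmf QA (h b) * w b"
    and w0: "\<And>b. b \<in> B \<Longrightarrow> 0 \<le> w b" and w\<eta>: "\<And>b. b \<in> B \<Longrightarrow> w b \<le> \<eta>"
    and w1: "\<And>y. y \<in> A \<Longrightarrow> (\<Sum>b | b \<in> B \<and> h b = y. w b) \<le> 1"
    and \<kappa>: "0 < \<kappa>" and \<eta>: "0 \<le> \<eta>"
begin

abbreviation r :: "'b \<Rightarrow> real" where "r \<equiv> pmf R"

abbreviation q :: "'a \<Rightarrow> real" where "q \<equiv> pmf QA"

definition fibre :: "'a \<Rightarrow> 'b set" where
  "fibre y = {b \<in> B. h b = y}"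

definition mass :: "'a \<Rightarrow> real" where
  "mass y = sum r (fibre y)"

text \<open>The contribution of the fibre to the fidelity, without the factor
  \<open>sqrt (q y)\<close>.\<close>

definition overlap :: "'a \<Rightarrow> real" where
  "overlap y = (\<Sum>b\<in>fibre y. sqrt (r b * w b))"

text \<open>By Cauchy-Schwarz, \<open>overlap y\<close> is at most
  \<open>sqrt (m * \<eta> * mass y)\<close> if \<open>R\<close> charges \<open>m\<close> points of
  the fibre. Exceeding the threshold therefore forces \<open>m\<close> above the square of
  \<open>\<kappa>\<close>.\<close>

definition relevant :: "'a set" where
  "relevant = {y \<in> A. \<kappa> * sqrt \<eta> * sqrt (mass y) < overlap y}"

section \<open>Estimates on relevant and irrelevant fibres\<close>

lemma finite_fibre [simp]: "finite (fibre y)"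
  using B by (simp add: fibre_def)

lemma fibreD: "b \<in> fibre y \<Longrightarrow> b \<in> B"
  by (simp add: fibre_def)

lemma mass_nonneg: "0 \<le> mass y"
  by (simp add: mass_def sum_nonneg)

lemma rw_nonneg: "b \<in> fibre y \<Longrightarrow> 0 \<le> r b * w b"
  using w0 fibreD by simp

lemma overlap_nonneg: "0 \<le> overlap y"
  unfolding overlap_def using rw_nonneg by (intro sum_nonneg) auto

lemma relevant_subset: "relevant \<subseteq> A" and finite_relevant [simp]: "finite relevant"
  using A by (auto simp: relevant_def)

lemma sum_fibres: "(\<Sum>y\<in>A. sum k (fibre y)) = sum k B" for k :: "'b \<Rightarrow> real"
  unfolding fibre_def using B A h by (intro sum.group) auto

lemma sum_relevant_fibres_le:
  fixes k :: "'b \<Rightarrow> real"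
  assumes "\<And>b. b \<in> B \<Longrightarrow> 0 \<le> k b"
  shows "(\<Sum>y\<in>relevant. sum k (fibre y)) \<le> sum k B"
  unfolding sum_fibres[symmetric] using A relevant_subset assms fibreD
  by (intro sum_mono2 sum_nonneg) auto

lemma overlap_pos:
  assumes "y \<in> relevant"
  shows "0 < overlap y"
proof -
  have "0 \<le> \<kappa> * sqrt \<eta> * sqrt (mass y)" using \<kappa> \<eta> mass_nonneg by simp
  then show ?thesis using assms by (simp add: relevant_def)
qed

lemma fidelity_eq_sum_overlap: "fidelity B R QB = (\<Sum>y\<in>A. sqrt (q y) * overlap y)"
proof -
  have "fidelity B R QB = (\<Sum>y\<in>A. \<Sum>b\<in>fibre y. sqrt (pmf R b) * sqrt (pmf QB b))"
    unfolding fidelity_def sum_fibres ..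
  also have "\<dots> = (\<Sum>y\<in>A. \<Sum>b\<in>fibre y. sqrt (q y) * sqrt (r b * w b))"
    by (intro sum.cong refl) (auto simp: fibre_def QB real_sqrt_mult)
  finally show ?thesis by (simp add: overlap_def sum_distrib_left)
qed

text \<open>The threshold leaves \<open>sqrt (q y) * sqrt (mass y)\<close> to be summed, and both
  \<open>q\<close> and \<open>mass\<close> have total at most 1.\<close>

lemma irrelevant_contribution: "(\<Sum>y\<in>A - relevant. sqrt (q y) * overlap y) \<le> \<kappa> * sqrt \<eta>"
proof -
  have "(\<Sum>y\<in>A - relevant. sqrt (q y) * overlap y)
      \<le> (\<Sum>y\<in>A - relevant. (\<kappa> * sqrt \<eta>) * (sqrt (q y) * sqrt (mass y)))"
  proof (rule sum_mono)
    fix y assume "y \<in> A - relevant"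
    then have "overlap y \<le> \<kappa> * sqrt \<eta> * sqrt (mass y)" by (auto simp: relevant_def)
    then have "sqrt (q y) * overlap y \<le> sqrt (q y) * (\<kappa> * sqrt \<eta> * sqrt (mass y))"
      by (intro mult_left_mono) auto
    then show "sqrt (q y) * overlap y \<le> (\<kappa> * sqrt \<eta>) * (sqrt (q y) * sqrt (mass y))"
      by (simp add: mult_ac)
  qed
  also have "\<dots> = (\<kappa> * sqrt \<eta>) * (\<Sum>y\<in>A - relevant. sqrt (q y) * sqrt (mass y))"
    by (simp add: sum_distrib_left)
  also have "(\<Sum>y\<in>A - relevant. sqrt (q y) * sqrt (mass y)) \<le> (\<Sum>y\<in>A. sqrt (q y) * sqrt (mass y))"
    using A mass_nonneg by (intro sum_mono2) auto
  also have "\<dots> \<le> sqrt (sum q A) * sqrt (sum mass A)"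
    using mass_nonneg by (intro sum_sqrt_mult_le) auto
  also have "sum mass A = 1"
    unfolding mass_def sum_fibres by (rule sum_pmf_carrier[OF B])
  also have "sqrt (sum q A) * sqrt 1 \<le> 1" using sum_pmf_le_1[OF A] by simp
  finally show ?thesis using \<kappa> \<eta> by (simp add: mult_left_mono)
qed

lemma relevant_fibre_support:
  assumes y: "y \<in> relevant"
  shows "\<kappa>\<^sup>2 \<le> real (card (fibre y \<inter> set_pmf R))"
proof -
  let ?D = "fibre y \<inter> set_pmf R"
  have "overlap y = (\<Sum>b\<in>?D. sqrt (r b * w b))"
    unfolding overlap_def by (intro sum.mono_neutral_right) (auto simp: set_pmf_iff)
  also have "\<dots> = (\<Sum>b\<in>?D. sqrt (r b) * sqrt (w b))" by (simp add: real_sqrt_mult)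
  also have "\<dots> \<le> sqrt (sum r ?D) * sqrt (sum w ?D)"
    using w0 fibreD by (intro sum_sqrt_mult_le) auto
  also have "\<dots> \<le> sqrt (mass y) * sqrt (card ?D * \<eta>)"
    unfolding mass_def using w0 fibreD w\<eta>
    by (intro mult_mono real_sqrt_le_mono sum_mono2 sum_bounded_above) (auto intro!: sum_nonneg)
  finally have "\<kappa> * sqrt \<eta> * sqrt (mass y) < sqrt (mass y) * sqrt (card ?D * \<eta>)"
    using y by (auto simp: relevant_def)
  then have "\<kappa> * (sqrt \<eta> * sqrt (mass y)) < sqrt (card ?D) * (sqrt \<eta> * sqrt (mass y))"
    by (simp add: real_sqrt_mult mult_ac)
  then have "\<kappa> < sqrt (card ?D)"
    using \<eta> mass_nonneg[of y] by (simp add: mult_less_cancel_right not_less)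
  then have "\<kappa>\<^sup>2 \<le> (sqrt (card ?D))\<^sup>2" using \<kappa> by (intro power_mono) auto
  then show ?thesis by simp
qed

text \<open>The fibres are disjoint and each relevant one uses up many points of the support. This
  is what makes a smaller storage sufficient.\<close>

lemma card_relevant: "card relevant * \<kappa>\<^sup>2 \<le> card (set_pmf R)"
proof -
  have "real (card relevant) * \<kappa>\<^sup>2 \<le> (\<Sum>y\<in>relevant. real (card (fibre y \<inter> set_pmf R)))"
    using sum_mono[of relevant "\<lambda>_. \<kappa>\<^sup>2" "\<lambda>y. real (card (fibre y \<inter> set_pmf R))"]
      relevant_fibre_support by simp
  also have "\<dots> = real (card (\<Union>y\<in>relevant. fibre y \<inter> set_pmf R))"
    by (subst card_UN_disjoint) (simp_all, auto simp: fibre_def)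
  also have "\<dots> \<le> real (card (set_pmf R))"
    using B by (intro of_nat_mono card_mono) (auto simp: prob_dists_def intro: finite_subset)
  finally show ?thesis .
qed

text \<open>A single point contributes at most \<open>sqrt (\<eta> * mass y)\<close>, so in a
  relevant fibre no point dominates the overlap.\<close>

lemma relevant_share_le:
  assumes y: "y \<in> relevant" and b: "b \<in> fibre y"
  shows "\<kappa> * sqrt (r b * w b) \<le> overlap y"
proof -
  have "r b \<le> mass y" unfolding mass_def using b by (intro member_le_sum) auto
  then have "r b * w b \<le> mass y * \<eta>"
    using w0 w\<eta> fibreD[OF b] mass_nonneg by (intro mult_mono) auto
  then have "sqrt (r b * w b) \<le> sqrt (mass y * \<eta>)" by (rule real_sqrt_le_mono)
  then have "\<kappa> * sqrt (r b * w b) \<le> \<kappa> * (sqrt \<eta> * sqrt (mass y))"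
    using \<kappa> by (intro mult_left_mono) (auto simp: real_sqrt_mult mult.commute)
  also have "\<dots> \<le> overlap y" using y by (simp add: relevant_def mult.assoc)
  finally show ?thesis .
qed

text \<open>A sum of squares is at most the largest term times the sum; the largest term is
  controlled by \<open>relevant_share_le\<close>.\<close>

lemma sum_share_squares:
  assumes y: "y \<in> relevant"
  shows "(\<Sum>b\<in>fibre y. r b * w b) \<le> (overlap y)\<^sup>2 / \<kappa>"
proof -
  have "\<kappa> * (\<Sum>b\<in>fibre y. r b * w b) = (\<Sum>b\<in>fibre y. (\<kappa> * sqrt (r b * w b)) * sqrt (r b * w b))"
    using rw_nonneg by (auto simp: sum_distrib_left mult.assoc intro!: sum.cong)
  also have "\<dots> \<le> (\<Sum>b\<in>fibre y. overlap y * sqrt (r b * w b))"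
    using relevant_share_le[OF y] rw_nonneg by (intro sum_mono mult_right_mono) auto
  also have "\<dots> = (overlap y)\<^sup>2"
    by (simp add: overlap_def sum_distrib_left[symmetric] power2_eq_square)
  finally show ?thesis using \<kappa> by (simp add: field_simps)
qed

end

text \<open>\<open>J\<close> and \<open>\<pi>\<close> are the data of
  \<open>majorized_coupling\<close>: atoms of \<open>P\<close> coupled to \<open>b\<close> are at
  most \<open>\<pi> b\<close>. The parameter \<open>K\<close> says how small these atoms must be
  compared with the squared overlap.\<close>

locale fibred_coupling = fibred_target A B R QB QA h w \<eta> \<kappa>
  for A :: "'a set" and B :: "'b set" and R QB :: "'b pmf" and QA :: "'a pmf"
    and h :: "'b \<Rightarrow> 'a" and w :: "'b \<Rightarrow> real" and \<eta> \<kappa> :: real +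
  fixes X :: "'x set" and P :: "'x pmf" and J :: "'x \<Rightarrow> 'b \<Rightarrow> real" and \<pi> :: "'b \<Rightarrow> real" and K :: real
  assumes X: "finite X" "P \<in> prob_dists X" and K: "0 < K"
    and J0: "\<And>x b. 0 \<le> J x b" and JX: "\<And>x. x \<in> X \<Longrightarrow> (\<Sum>b\<in>B. J x b) = pmf P x"
    and JB: "\<And>b. b \<in> B \<Longrightarrow> (\<Sum>x\<in>X. J x b) = pmf R b"
    and \<pi>0: "\<And>b. 0 \<le> \<pi> b" and \<pi>1: "sum \<pi> B \<le> 1"
    and J\<pi>: "\<And>x b. x \<in> X \<Longrightarrow> b \<in> B \<Longrightarrow> 0 < J x b \<Longrightarrow> pmf P x \<le> \<pi> b"
begin

text \<open>Atoms of \<open>P\<close> coupled to a good point are at most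
  \<open>(overlap y)^2 / K\<close>, which for large \<open>K\<close> is small compared with the mass
  to be placed on \<open>y\<close>.\<close>

definition good :: "'a \<Rightarrow> 'b set" where
  "good y = {b \<in> fibre y. K * \<pi> b \<le> (overlap y)\<^sup>2}"

definition defect :: "'a \<Rightarrow> real" where
  "defect y = (\<Sum>b\<in>fibre y - good y. sqrt (r b * w b))"

text \<open>At least half of the overlap must come from good points; this makes
  \<open>filling y\<close> at least a quarter of the squared overlap.\<close>

definition fillable :: "'a set" where
  "fillable = {y \<in> relevant. 2 * defect y \<le> overlap y}"

definition filling :: "'a \<Rightarrow> real" where
  "filling y = sum r (good y)"

text \<open>The random assignment sends \<open>x\<close> to \<open>y\<close> with probability
  \<open>weight x y / pmf P x\<close>: follow the coupling and keep only good points.\<close>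

definition weight :: "'x \<Rightarrow> 'a \<Rightarrow> real" where
  "weight x y = (\<Sum>b\<in>good y. J x b)"

section \<open>Losses at bad points, and the assignment built from good ones\<close>

lemma good_subset: "good y \<subseteq> fibre y"
  by (auto simp: good_def)

lemma goodD: "b \<in> good y \<Longrightarrow> b \<in> B"
  using good_subset fibreD by blast

lemma fillable_subset: "fillable \<subseteq> relevant" and finite_fillable [simp]: "finite fillable"
  by (auto simp: fillable_def)

lemma defect_nonneg: "0 \<le> defect y"
  unfolding defect_def using rw_nonneg by (intro sum_nonneg) auto

lemma weight_nonneg: "0 \<le> weight x y"
  by (simp add: weight_def J0 sum_nonneg)

text \<open>At a bad point \<open>sqrt (K * \<pi> b)\<close> exceeds \<open>overlap y\<close>, so
  their quotient may be inserted as a factor. The result is shaped for Cauchy-Schwarz against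
  \<open>\<pi>\<close>.\<close>

lemma defect_le:
  assumes y: "y \<in> relevant"
  shows "sqrt (q y) * defect y
    \<le> (\<Sum>b\<in>fibre y. sqrt K * (sqrt (\<pi> b) * sqrt (q y * (r b * w b / (overlap y)\<^sup>2))))"
proof -
  let ?t = "\<lambda>b. sqrt K * (sqrt (\<pi> b) * sqrt (q y * (r b * w b / (overlap y)\<^sup>2)))"
  note u = overlap_pos[OF y]
  have "sqrt (q y) * defect y = (\<Sum>b\<in>fibre y - good y. sqrt (q y) * sqrt (r b * w b))"
    by (simp add: defect_def sum_distrib_left)
  also have "\<dots> \<le> (\<Sum>b\<in>fibre y - good y. ?t b)"
  proof (rule sum_mono)
    fix b assume b: "b \<in> fibre y - good y"
    then have "(overlap y)\<^sup>2 \<le> K * \<pi> b" by (auto simp: good_def)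
    then have "sqrt ((overlap y)\<^sup>2) \<le> sqrt (K * \<pi> b)" by (rule real_sqrt_le_mono)
    then have "overlap y \<le> sqrt K * sqrt (\<pi> b)"
      using u by (simp add: real_sqrt_mult)
    then have "overlap y * (sqrt (q y) * (sqrt (r b * w b) / overlap y))
        \<le> (sqrt K * sqrt (\<pi> b)) * (sqrt (q y) * (sqrt (r b * w b) / overlap y))"
      using rw_nonneg[of b y] b u by (intro mult_right_mono) auto
    moreover have "sqrt (q y * (r b * w b / (overlap y)\<^sup>2)) = sqrt (q y) * (sqrt (r b * w b) / overlap y)"
      using u by (simp add: real_sqrt_mult real_sqrt_divide)
    ultimately show "sqrt (q y) * sqrt (r b * w b) \<le> ?t b" using u by (simp add: mult.assoc)
  qed
  also have "\<dots> \<le> (\<Sum>b\<in>fibre y. ?t b)"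
    using K \<pi>0 w0 fibreD by (intro sum_mono2) auto
  finally show ?thesis .
qed

text \<open>Cauchy-Schwarz over all pairs of a relevant \<open>y\<close> and a point of its fibre:
  \<open>\<pi>\<close> has total at most 1, and the normalized shares \<open>s y b\<close> sum to at
  most \<open>1 / \<kappa>\<close> in each fibre by \<open>sum_share_squares\<close>.\<close>

lemma sum_defect_le: "(\<Sum>y\<in>relevant. sqrt (q y) * defect y) \<le> sqrt (K / \<kappa>)"
proof -
  define s where "s y b = r b * w b / (overlap y)\<^sup>2" for y b
  have s0: "0 \<le> s y b" if "b \<in> fibre y" for y b
    using rw_nonneg[OF that] by (simp add: s_def)
  have s1: "(\<Sum>b\<in>fibre y. s y b) \<le> 1 / \<kappa>" if y: "y \<in> relevant" for y
    using sum_share_squares[OF y] overlap_pos[OF y] \<kappa>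
    by (simp add: s_def sum_divide_distrib[symmetric] field_simps)
  have "(\<Sum>y\<in>relevant. sqrt (q y) * defect y)
      \<le> (\<Sum>y\<in>relevant. \<Sum>b\<in>fibre y. sqrt K * (sqrt (\<pi> b) * sqrt (q y * s y b)))"
    unfolding s_def by (intro sum_mono defect_le)
  also have "\<dots> = sqrt K * (\<Sum>y\<in>relevant. \<Sum>b\<in>fibre y. sqrt (\<pi> b) * sqrt (q y * s y b))"
    by (simp add: sum_distrib_left)
  also have "(\<Sum>y\<in>relevant. \<Sum>b\<in>fibre y. sqrt (\<pi> b) * sqrt (q y * s y b))
      = (\<Sum>i\<in>Sigma relevant fibre. sqrt (\<pi> (snd i)) * sqrt (q (fst i) * s (fst i) (snd i)))"
    by (subst sum.Sigma) (auto simp: case_prod_unfold)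
  also have "\<dots> \<le> sqrt (\<Sum>i\<in>Sigma relevant fibre. \<pi> (snd i))
      * sqrt (\<Sum>i\<in>Sigma relevant fibre. q (fst i) * s (fst i) (snd i))"
    using \<pi>0 s0 by (intro sum_sqrt_mult_le) auto
  also have "\<dots> \<le> sqrt 1 * sqrt (1 / \<kappa>)"
  proof (intro mult_mono real_sqrt_le_mono)
    have "(\<Sum>i\<in>Sigma relevant fibre. \<pi> (snd i)) = (\<Sum>y\<in>relevant. \<Sum>b\<in>fibre y. \<pi> b)"
      by (subst sum.Sigma) (auto simp: case_prod_unfold)
    then show "(\<Sum>i\<in>Sigma relevant fibre. \<pi> (snd i)) \<le> 1"
      using sum_relevant_fibres_le[of \<pi>] \<pi>0 \<pi>1 by simp
    have "(\<Sum>i\<in>Sigma relevant fibre. q (fst i) * s (fst i) (snd i))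
        = (\<Sum>y\<in>relevant. q y * (\<Sum>b\<in>fibre y. s y b))"
      by (subst sum_distrib_left, subst sum.Sigma) (auto simp: case_prod_unfold)
    also have "\<dots> \<le> (\<Sum>y\<in>relevant. q y * (1 / \<kappa>))"
      using s1 by (intro sum_mono mult_left_mono) auto
    also have "\<dots> = sum q relevant * (1 / \<kappa>)" by (simp add: sum_divide_distrib)
    also have "\<dots> \<le> 1 * (1 / \<kappa>)" using sum_pmf_le_1[OF finite_relevant] \<kappa> by (intro mult_right_mono) auto
    finally show "(\<Sum>i\<in>Sigma relevant fibre. q (fst i) * s (fst i) (snd i)) \<le> 1 / \<kappa>" by simp
  qed (use \<pi>0 s0 \<kappa> in \<open>auto intro!: sum_nonneg mult_nonneg_nonneg\<close>)
  finally show ?thesis using K \<kappa> by (simp add: real_sqrt_divide mult_left_mono)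
qed

text \<open>Cauchy-Schwarz over the good points, where \<open>w\<close> has total at most 1.\<close>

lemma filling_bounds:
  assumes y: "y \<in> fillable"
  shows "overlap y / 2 \<le> sqrt (filling y)" and "overlap y - defect y \<le> sqrt (filling y)"
    and "0 < filling y"
proof -
  have yr: "y \<in> relevant" "y \<in> A" and d: "2 * defect y \<le> overlap y"
    using y relevant_subset by (auto simp: fillable_def)
  have "overlap y - defect y = (\<Sum>b\<in>good y. sqrt (r b) * sqrt (w b))"
    unfolding overlap_def defect_def
    by (simp add: real_sqrt_mult sum.subset_diff[OF good_subset finite_fibre])
  also have "\<dots> \<le> sqrt (filling y) * sqrt (sum w (good y))"
    unfolding filling_def using w0 goodD by (intro sum_sqrt_mult_le) auto
  also have "\<dots> \<le> sqrt (filling y) * 1"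
  proof (rule mult_left_mono)
    have "sum w (good y) \<le> sum w (fibre y)" using good_subset w0 fibreD by (intro sum_mono2) auto
    then show "sqrt (sum w (good y)) \<le> 1" using w1[OF yr(2)] by (simp add: fibre_def)
  qed (auto simp: filling_def sum_nonneg)
  finally show 1: "overlap y - defect y \<le> sqrt (filling y)" by simp
  then show 2: "overlap y / 2 \<le> sqrt (filling y)" using d by simp
  have "0 < sqrt (filling y)" using 2 overlap_pos[OF yr(1)] by linarith
  then show "0 < filling y" by simp
qed

lemma sum_weight_le:
  assumes "x \<in> X"
  shows "sum (weight x) fillable \<le> pmf P x"
proof -
  have "sum (weight x) fillable \<le> (\<Sum>y\<in>fillable. sum (J x) (fibre y))"
    unfolding weight_def using good_subset J0 by (intro sum_mono sum_mono2) auto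
  also have "\<dots> \<le> (\<Sum>y\<in>relevant. sum (J x) (fibre y))"
    using fillable_subset J0 by (intro sum_mono2 sum_nonneg) auto
  also have "\<dots> \<le> pmf P x" using sum_relevant_fibres_le[of "J x"] J0 JX assms by simp
  finally show ?thesis .
qed

lemma sum_weight_eq_filling: "(\<Sum>x\<in>X. weight x y) = filling y"
proof -
  have "(\<Sum>x\<in>X. weight x y) = (\<Sum>b\<in>good y. \<Sum>x\<in>X. J x b)" unfolding weight_def by (rule sum.swap)
  also have "\<dots> = filling y" unfolding filling_def using JB goodD by (intro sum.cong) auto
  finally show ?thesis .
qed

text \<open>This is the additional second-moment term in \<open>derandomized_assignment\<close>; the
  coupling charges a good point only with small atoms.\<close>

lemma weight_variance_le: "(\<Sum>x\<in>X. pmf P x * weight x y) \<le> (overlap y)\<^sup>2 / K * filling y"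
proof -
  have "(\<Sum>x\<in>X. pmf P x * weight x y) \<le> (\<Sum>x\<in>X. (overlap y)\<^sup>2 / K * weight x y)"
  proof (rule sum_mono)
    fix x assume x: "x \<in> X"
    have "pmf P x * J x b \<le> (overlap y)\<^sup>2 / K * J x b" if b: "b \<in> good y" for b
    proof (cases "J x b = 0")
      case False
      then have "pmf P x \<le> \<pi> b" using J\<pi>[OF x goodD[OF b]] J0[of x b] by simp
      also have "\<pi> b \<le> (overlap y)\<^sup>2 / K" using b K by (simp add: good_def field_simps)
      finally show ?thesis using J0 by (rule mult_right_mono)
    qed simp
    then show "pmf P x * weight x y \<le> (overlap y)\<^sup>2 / K * weight x y"
      unfolding weight_def sum_distrib_left by (rule sum_mono)
  qed
  then show ?thesis unfolding sum_distrib_left[symmetric] sum_weight_eq_filling .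
qed

text \<open>The right-hand side is the minorant of \<open>sqrt_ge_quadratic\<close> at
  \<open>c = filling y\<close>, evaluated at mean \<open>filling y\<close> with \<open>V\<close>
  added to the squared mean. Since \<open>overlap y\<close> is at most
  \<open>2 * sqrt (filling y)\<close>, that addition costs at most
  \<open>overlap y / K\<close>.\<close>

lemma assignment_target:
  fixes V :: real
  assumes y: "y \<in> fillable" and V: "V \<le> (overlap y)\<^sup>2 / K * filling y"
  shows "sqrt (q y) * (overlap y - defect y - overlap y / K)
    \<le> 3 * sqrt (q y) / (2 * sqrt (filling y)) * filling y
      - sqrt (q y) / (2 * filling y * sqrt (filling y)) * ((filling y)\<^sup>2 + V)"
proof -
  define s where "s = sqrt (filling y)"
  have s: "0 < s" "filling y = s * s" using filling_bounds(3)[OF y] by (simp_all add: s_def)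
  have up: "0 < overlap y" using overlap_pos y fillable_subset by auto
  have "overlap y * overlap y \<le> overlap y * (2 * s)"
    using filling_bounds(1)[OF y] up by (intro mult_left_mono) (auto simp: s_def)
  then have "(overlap y)\<^sup>2 / (2 * K * s) \<le> overlap y / K"
    using s K by (simp add: field_simps power2_eq_square)
  then have "overlap y - defect y - overlap y / K \<le> s - (overlap y)\<^sup>2 / (2 * K * s)"
    using filling_bounds(2)[OF y] by (simp add: s_def)
  then have "sqrt (q y) * (overlap y - defect y - overlap y / K)
      \<le> sqrt (q y) * (s - (overlap y)\<^sup>2 / (2 * K * s))"
    by (intro mult_left_mono) auto
  also have "\<dots> = 3 * sqrt (q y) / (2 * s) * (s * s)
      - sqrt (q y) / (2 * (s * s) * s) * ((s * s)\<^sup>2 + (overlap y)\<^sup>2 / K * (s * s))"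
    using s K by (simp add: field_simps power2_eq_square)
  also have "\<dots> \<le> 3 * sqrt (q y) / (2 * s) * (s * s) - sqrt (q y) / (2 * (s * s) * s) * ((s * s)\<^sup>2 + V)"
    using V s by (intro diff_left_mono mult_left_mono add_left_mono) auto
  finally show ?thesis unfolding s_def[symmetric] unfolding s(2) .
qed

lemma assignment:
  obtains g :: "'x \<Rightarrow> 'a option"
  where "\<And>x. x \<in> X \<Longrightarrow> g x \<in> insert None (Some ` fillable)"
    and "(\<Sum>y\<in>fillable. sqrt (q y) * (overlap y - defect y - overlap y / K))
      \<le> (\<Sum>y\<in>fillable. sqrt (q y) * sqrt (\<Sum>x | x \<in> X \<and> g x = Some y. pmf P x))"
proof -
  \<comment> \<open>Linear and quadratic coefficients of the minorant in
    \<open>sqrt_ge_quadratic\<close> with \<open>c = filling y\<close>.\<close>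
  define a where "a y = 3 * sqrt (q y) / (2 * sqrt (filling y))" for y
  define b where "b y = sqrt (q y) / (2 * filling y * sqrt (filling y))" for y
  define Z where "Z g y = (\<Sum>x | x \<in> X \<and> g x = Some y. pmf P x)" for g :: "'x \<Rightarrow> 'a option" and y
  have b0: "0 \<le> b y" if "y \<in> fillable" for y using filling_bounds(3)[OF that] by (simp add: b_def)
  obtain g where g: "\<forall>x\<in>X. g x \<in> insert None (Some ` fillable)"
    and gV: "(\<Sum>y\<in>fillable. a y * (0 + (\<Sum>x\<in>X. weight x y))
        - b y * ((0 + (\<Sum>x\<in>X. weight x y))\<^sup>2 + (\<Sum>x\<in>X. pmf P x * weight x y)))
      \<le> (\<Sum>y\<in>fillable. a y * (0 + Z g y) - b y * (0 + Z g y)\<^sup>2)"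
    using derandomized_assignment[OF X(1) finite_fillable, of "pmf P" weight b a "\<lambda>_. 0"]
      weight_nonneg sum_weight_le b0
    unfolding Z_def by auto
  have "(\<Sum>y\<in>fillable. sqrt (q y) * (overlap y - defect y - overlap y / K))
      \<le> (\<Sum>y\<in>fillable. a y * filling y - b y * ((filling y)\<^sup>2 + (\<Sum>x\<in>X. pmf P x * weight x y)))"
    unfolding a_def b_def by (intro sum_mono assignment_target weight_variance_le)
  also have "\<dots> \<le> (\<Sum>y\<in>fillable. a y * Z g y - b y * (Z g y)\<^sup>2)"
    using gV by (simp add: sum_weight_eq_filling)
  also have "\<dots> \<le> (\<Sum>y\<in>fillable. sqrt (q y) * sqrt (Z g y))"
  proof (rule sum_mono)
    fix y assume y: "y \<in> fillable"
    define s where "s = sqrt (filling y)"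
    have s: "0 < s" "filling y = s * s" using filling_bounds(3)[OF y] by (simp_all add: s_def)
    have "a y * Z g y - b y * (Z g y)\<^sup>2
        = sqrt (q y) * (s * (3 * (Z g y / (s * s)) - (Z g y / (s * s))\<^sup>2) / 2)"
      using s(1) by (simp add: a_def b_def s_def[symmetric] s(2) field_simps power2_eq_square)
    also have "\<dots> \<le> sqrt (q y) * sqrt (Z g y)"
      unfolding s(2)[symmetric] unfolding s_def using filling_bounds(3)[OF y]
      by (intro mult_left_mono sqrt_ge_quadratic) (auto simp: Z_def sum_nonneg)
    finally show "a y * Z g y - b y * (Z g y)\<^sup>2 \<le> sqrt (q y) * sqrt (Z g y)" .
  qed
  finally show thesis using that g unfolding Z_def by blast
qed

text \<open>The three losses come from irrelevant fibres, bad points and the variance. Defects count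
  twice: a relevant fibre that is not fillable has \<open>overlap y < 2 * defect y\<close>, so the
  second defect pays for dropping it.\<close>

lemma fidelity_loss:
  "fidelity B R QB - \<kappa> * sqrt \<eta> - 2 * sqrt (K / \<kappa>) - 1 / K
    \<le> (\<Sum>y\<in>fillable. sqrt (q y) * (overlap y - defect y - overlap y / K))"
proof -
  have "(\<Sum>y\<in>relevant. sqrt (q y) * overlap y - 2 * (sqrt (q y) * defect y) - sqrt (q y) * overlap y / K)
      \<le> (\<Sum>y\<in>relevant. if y \<in> fillable then sqrt (q y) * (overlap y - defect y - overlap y / K) else 0)"
  proof (rule sum_mono)
    fix y assume y: "y \<in> relevant"
    have "0 \<le> sqrt (q y) * defect y" "0 \<le> sqrt (q y) * overlap y / K"
      using defect_nonneg overlap_nonneg K by auto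
    moreover have "sqrt (q y) * overlap y \<le> sqrt (q y) * (2 * defect y)" if "y \<notin> fillable"
      using that y by (intro mult_left_mono) (auto simp: fillable_def)
    ultimately show "sqrt (q y) * overlap y - 2 * (sqrt (q y) * defect y) - sqrt (q y) * overlap y / K
      \<le> (if y \<in> fillable then sqrt (q y) * (overlap y - defect y - overlap y / K) else 0)"
      by (auto simp: algebra_simps)
  qed
  also have "\<dots> = (\<Sum>y\<in>fillable. sqrt (q y) * (overlap y - defect y - overlap y / K))"
    using fillable_subset by (simp add: sum.inter_restrict[symmetric] Int_absorb1)
  finally have "(\<Sum>y\<in>relevant. sqrt (q y) * overlap y) - 2 * (\<Sum>y\<in>relevant. sqrt (q y) * defect y)
      - (\<Sum>y\<in>relevant. sqrt (q y) * overlap y) / K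
      \<le> (\<Sum>y\<in>fillable. sqrt (q y) * (overlap y - defect y - overlap y / K))"
    by (simp add: sum_subtractf sum_distrib_left sum_divide_distrib)
  moreover have "(\<Sum>y\<in>relevant. sqrt (q y) * overlap y) / K \<le> 1 / K"
  proof -
    have "(\<Sum>y\<in>relevant. sqrt (q y) * overlap y) \<le> fidelity B R QB"
      unfolding fidelity_eq_sum_overlap using A relevant_subset overlap_nonneg
      by (intro sum_mono2) auto
    also have "\<dots> \<le> 1" by (rule fidelity_le_1[OF B(1)])
    finally show ?thesis using K by (simp add: divide_right_mono)
  qed
  moreover have "fidelity B R QB
      = (\<Sum>y\<in>A - relevant. sqrt (q y) * overlap y) + (\<Sum>y\<in>relevant. sqrt (q y) * overlap y)"
    unfolding fidelity_eq_sum_overlap by (rule sum.subset_diff[OF relevant_subset A])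
  ultimately show ?thesis using irrelevant_contribution sum_defect_le by linarith
qed

text \<open>Points left unassigned go to one fixed relevant point: this only adds mass, and the
  image stays within the few relevant points.\<close>

lemma deterministic_map:
  assumes "relevant \<noteq> {}"
  obtains f where "f ` X \<subseteq> relevant"
    and "fidelity B R QB - \<kappa> * sqrt \<eta> - 2 * sqrt (K / \<kappa>) - 1 / K \<le> fidelity A (map_pmf f P) QA"
proof -
  obtain e0 where e0: "e0 \<in> relevant" using assms by blast
  obtain g :: "'x \<Rightarrow> 'a option" where g: "\<And>x. x \<in> X \<Longrightarrow> g x \<in> insert None (Some ` fillable)"
    and V: "(\<Sum>y\<in>fillable. sqrt (q y) * (overlap y - defect y - overlap y / K))
      \<le> (\<Sum>y\<in>fillable. sqrt (q y) * sqrt (\<Sum>x | x \<in> X \<and> g x = Some y. pmf P x))"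
    using assignment by blast
  define f where "f x = (case g x of Some y \<Rightarrow> y | None \<Rightarrow> e0)" for x
  have fR: "f ` X \<subseteq> relevant"
    using g e0 fillable_subset by (force simp: f_def split: option.split)
  have "(\<Sum>x | x \<in> X \<and> g x = Some y. pmf P x) \<le> pmf (map_pmf f P) y" for y
    unfolding pmf_map_sum[OF X] using X by (intro sum_mono2) (auto simp: f_def)
  then have "(\<Sum>y\<in>fillable. sqrt (q y) * sqrt (\<Sum>x | x \<in> X \<and> g x = Some y. pmf P x))
      \<le> (\<Sum>y\<in>fillable. sqrt (pmf (map_pmf f P) y) * sqrt (q y))"
    by (intro sum_mono) (simp add: mult.commute mult_left_mono)
  also have "\<dots> \<le> fidelity A (map_pmf f P) QA"
    unfolding fidelity_def using A fillable_subset relevant_subset by (intro sum_mono2) auto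
  finally show thesis using that[OF fR] V fidelity_loss by linarith
qed

end

text \<open>\<open>M\<close> is the number of available storage elements; the support bound and
  \<open>card_relevant\<close> leave at most \<open>M\<close> relevant points.\<close>

lemma deterministic_from_majorized:
  fixes P :: "'x pmf" and QA :: "'a pmf" and QB R :: "'b pmf" and h :: "'b \<Rightarrow> 'a" and w :: "'b \<Rightarrow> real"
    and \<kappa> :: real
  assumes X: "finite X" "P \<in> prob_dists X" and A: "finite A" "A \<noteq> {}"
    and B: "finite B" "R \<in> prob_dists B" and maj: "majorized X P B R"
    and h: "h \<in> B \<rightarrow> A" and QB: "\<And>b. b \<in> B \<Longrightarrow> pmf QB b = pmf QA (h b) * w b"
    and w0: "\<And>b. b \<in> B \<Longrightarrow> 0 \<le> w b" and w\<eta>: "\<And>b. b \<in> B \<Longrightarrow> w b \<le> \<eta>"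
    and w1: "\<And>y. y \<in> A \<Longrightarrow> (\<Sum>b | b \<in> B \<and> h b = y. w b) \<le> 1"
    and M': "real (card (set_pmf R)) \<le> \<kappa>\<^sup>2 * real M" and M: "1 \<le> M"
    and \<kappa>: "0 < \<kappa>" and K: "0 < K" and \<eta>: "0 \<le> \<eta>"
  obtains f where "f \<in> X \<rightarrow> A" "card (f ` X) \<le> M"
    "fidelity B R QB - \<kappa> * sqrt \<eta> - 2 * sqrt (K / \<kappa>) - 1 / K \<le> fidelity A (map_pmf f P) QA"
proof -
  obtain J \<pi> where J: "\<And>x b. 0 \<le> J x b" "\<And>x. x \<in> X \<Longrightarrow> (\<Sum>b\<in>B. J x b) = pmf P x"
    "\<And>b. b \<in> B \<Longrightarrow> (\<Sum>x\<in>X. J x b) = pmf R b" "\<And>b. 0 \<le> \<pi> b" "sum \<pi> B \<le> 1"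
    "\<And>x b. x \<in> X \<Longrightarrow> b \<in> B \<Longrightarrow> 0 < J x b \<Longrightarrow> pmf P x \<le> \<pi> b"
    by (rule majorized_coupling[OF X B maj]) (rule that)
  obtain a where a: "a \<in> A" using A by blast
  interpret fibred_coupling A B R QB QA h w \<eta> \<kappa> X P J \<pi> K
    by unfold_locales (fact X A B h QB w0 w\<eta> w1 \<kappa> K \<eta> J)+
  show thesis
  proof (cases "relevant = {}")
    \<comment> \<open>The whole fidelity is then within the permitted loss, and a constant map
      suffices.\<close>
    case True
    then have "fidelity B R QB \<le> \<kappa> * sqrt \<eta>"
      using irrelevant_contribution by (simp add: fidelity_eq_sum_overlap)
    moreover have "0 \<le> sqrt (K / \<kappa>)" "0 \<le> 1 / K" using K \<kappa> by auto
    ultimately have "fidelity B R QB - \<kappa> * sqrt \<eta> - 2 * sqrt (K / \<kappa>) - 1 / K \<le> 0" by linarith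
    moreover have "card ((\<lambda>_. a) ` X) \<le> M"
      using M card_mono[of "{a}" "(\<lambda>_. a) ` X"] by (simp add: image_subset_iff)
    ultimately show thesis
      using a fidelity_nonneg[of A "map_pmf (\<lambda>_. a) P" QA] by (intro that[of "\<lambda>_. a"]) (auto intro: order_trans)
  next
    case False
    obtain f where f: "f ` X \<subseteq> relevant"
      "fidelity B R QB - \<kappa> * sqrt \<eta> - 2 * sqrt (K / \<kappa>) - 1 / K \<le> fidelity A (map_pmf f P) QA"
      using deterministic_map[OF False] by blast
    have "real (card relevant) * \<kappa>\<^sup>2 \<le> real M * \<kappa>\<^sup>2"
      using card_relevant M' by (simp add: mult.commute)
    then have "card relevant \<le> M" using \<kappa> by simp
    moreover have "card (f ` X) \<le> card relevant" using f(1) by (intro card_mono) auto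
    ultimately show thesis using that[of f] f relevant_subset by auto
  qed
qed

section \<open>Conversion of powers\<close>

lemma card_storage: "card (storage N) = nat \<lfloor>2 powr N\<rfloor>"
  by (simp add: storage_def)

lemma finite_storage [simp]: "finite (storage N)"
  by (simp add: storage_def)

lemma card_storage_bounds:
  assumes "0 \<le> N"
  shows "1 \<le> card (storage N)" and "2 powr N / 2 \<le> card (storage N)" and "card (storage N) \<le> 2 powr N"
proof -
  have "(2::real) powr 0 \<le> 2 powr N" using assms by (intro powr_mono) auto
  then have 1: "1 \<le> \<lfloor>2 powr N :: real\<rfloor>" by simp
  then show "1 \<le> card (storage N)" by (simp add: card_storage le_nat_iff)
  have "real (card (storage N)) = of_int \<lfloor>2 powr N\<rfloor>" using 1 by (simp add: card_storage)
  then show "2 powr N / 2 \<le> card (storage N)" "card (storage N) \<le> 2 powr N"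
    using 1 by linarith+
qed

lemma storage_nonempty: "0 \<le> N \<Longrightarrow> storage N \<noteq> {}"
  using card_storage_bounds(1)[of N] by auto

lemma bdd_above_fidelity: "finite Y \<Longrightarrow> bdd_above {fidelity Y R Q | R. \<Phi> R}"
  using fidelity_le_1 by (auto intro!: bdd_aboveI[of _ 1])

lemma fid_det_le_fid_maj:
  assumes X: "finite X" "P \<in> prob_dists X" and Y: "finite Y" "Y \<noteq> {}" and N: "0 \<le> N"
  shows "fid_det X P Y Q N \<le> fid_maj X P Y Q N"
  unfolding fid_det_def fid_maj_def
proof (rule cSup_subset_mono)
  \<comment> \<open>A real \<open>Sup\<close> is unspecified on the empty set; constant maps show
    that the set is nonempty.\<close>
  obtain k y where "k \<in> storage N" "y \<in> Y" using storage_nonempty[OF N] Y by blast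
  then have "(\<lambda>_. k) \<in> X \<rightarrow> storage N" "(\<lambda>_. y) \<in> storage N \<rightarrow> Y" by auto
  then show "{fidelity Y (map_pmf f' (map_pmf f P)) Q | f f'. f \<in> X \<rightarrow> storage N \<and> f' \<in> storage N \<rightarrow> Y} \<noteq> {}"
    by blast
  show "{fidelity Y (map_pmf f' (map_pmf f P)) Q | f f'. f \<in> X \<rightarrow> storage N \<and> f' \<in> storage N \<rightarrow> Y}
      \<subseteq> {fidelity Y P'' Q | P''. P'' \<in> prob_dists Y \<and>
            (\<exists>P'\<in>prob_dists (storage N).
               majorized X P (storage N) P' \<and> majorized (storage N) P' Y P'')}"
  proof clarify
    fix f :: "'a \<Rightarrow> nat" and f' :: "nat \<Rightarrow> 'b"
    assume f: "f \<in> X \<rightarrow> storage N" and f': "f' \<in> storage N \<rightarrow> Y"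
    have P': "map_pmf f P \<in> prob_dists (storage N)" using X(2) f by (rule map_pmf_prob_dists)
    moreover have "map_pmf f' (map_pmf f P) \<in> prob_dists Y"
      using P' f' by (rule map_pmf_prob_dists)
    moreover have "majorized X P (storage N) (map_pmf f P)"
      using X f by (intro majorized_map) auto
    moreover have "majorized (storage N) (map_pmf f P) Y (map_pmf f' (map_pmf f P))"
      using Y f' P' by (intro majorized_map) auto
    ultimately show "\<exists>P''. fidelity Y (map_pmf f' (map_pmf f P)) Q = fidelity Y P'' Q \<and> P'' \<in> prob_dists Y \<and>
            (\<exists>P'\<in>prob_dists (storage N).
               majorized X P (storage N) P' \<and> majorized (storage N) P' Y P'')"
      by blast
  qed
qed (rule bdd_above_fidelity[OF Y(1)])

text \<open>A map with a small image factors through the storage by numbering its image.\<close>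

lemma fidelity_le_fid_det:
  assumes Y: "finite Y" "y0 \<in> Y" and X: "finite X" "P \<in> prob_dists X"
    and f: "f \<in> X \<rightarrow> Y" "card (f ` X) \<le> card (storage N)"
  shows "fidelity Y (map_pmf f P) Q \<le> fid_det X P Y Q N"
proof -
  have fin: "finite (f ` X)" using X by simp
  obtain j where j: "bij_betw j (f ` X) {..<card (f ` X)}"
    using ex_bij_betw_finite_nat[OF fin] by (auto simp: atLeast0LessThan)
  \<comment> \<open>Storage elements beyond the numbered image are sent to the default
    \<open>y0\<close>, to keep \<open>f'\<close> inside \<open>Y\<close>.\<close>
  define f' where "f' i = (if i < card (f ` X) then inv_into (f ` X) j i else y0)" for i
  have f'j: "f' (j (f x)) = f x" if "x \<in> X" for x
    using j that by (auto simp: f'_def bij_betw_def)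
  have "f' \<in> storage N \<rightarrow> Y"
  proof
    fix i
    have "inv_into (f ` X) j i \<in> f ` X" if "i < card (f ` X)"
      using j that by (intro inv_into_into) (auto simp: bij_betw_def)
    moreover have "f ` X \<subseteq> Y" using f(1) by auto
    ultimately show "f' i \<in> Y" using Y(2) by (auto simp: f'_def)
  qed
  moreover have "j \<circ> f \<in> X \<rightarrow> storage N"
  proof
    fix x assume "x \<in> X"
    then have "j (f x) \<in> {..<card (f ` X)}" using bij_betw_apply[OF j] by blast
    then show "(j \<circ> f) x \<in> storage N" using f(2) by (simp add: card_storage) (simp add: storage_def)
  qed
  moreover have map_eq: "map_pmf f' (map_pmf (j \<circ> f) P) = map_pmf f P"
    unfolding pmf.map_comp using X f'j by (intro map_pmf_cong) (auto simp: prob_dists_def)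
  moreover have "bdd_above {fidelity Y (map_pmf f' (map_pmf f P)) Q | f f'. f \<in> X \<rightarrow> storage N \<and> f' \<in> storage N \<rightarrow> Y}"
    using fidelity_le_1[OF Y(1)] by (auto intro!: bdd_aboveI[of _ 1])
  ultimately have "fidelity Y (map_pmf f' (map_pmf (j \<circ> f) P)) Q \<le> fid_det X P Y Q N"
    unfolding fid_det_def by (intro cSup_upper) blast+
  with map_eq show ?thesis by simp
qed

text \<open>The intermediate distribution \<open>P'\<close> is eliminated: transitivity relates
  \<open>P\<close> to \<open>R\<close> directly, and the storage survives as a bound on the support
  of \<open>R\<close>.\<close>

lemma fid_maj_le_fid_det:
  fixes P :: "'x pmf" and QA :: "'a pmf" and QB :: "'b pmf" and h :: "'b \<Rightarrow> 'a" and w :: "'b \<Rightarrow> real"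
    and \<kappa> :: real
  assumes X: "finite X" "P \<in> prob_dists X" and A: "finite A" "A \<noteq> {}"
    and B: "finite B" "B \<noteq> {}"
    and h: "h \<in> B \<rightarrow> A" and QB: "\<And>b. b \<in> B \<Longrightarrow> pmf QB b = pmf QA (h b) * w b"
    and w0: "\<And>b. b \<in> B \<Longrightarrow> 0 \<le> w b" and w\<eta>: "\<And>b. b \<in> B \<Longrightarrow> w b \<le> \<eta>"
    and w1: "\<And>y. y \<in> A \<Longrightarrow> (\<Sum>b | b \<in> B \<and> h b = y. w b) \<le> 1"
    and N: "0 \<le> N" "0 \<le> N'" and card: "card (storage N') \<le> \<kappa>\<^sup>2 * card (storage N)"
    and \<kappa>: "0 < \<kappa>" and K: "0 < K" and \<eta>: "0 \<le> \<eta>"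
  shows "fid_maj X P B QB N' \<le> fid_det X P A QA N + (\<kappa> * sqrt \<eta> + 2 * sqrt (K / \<kappa>) + 1 / K)"
  unfolding fid_maj_def
proof (rule cSup_least)
  \<comment> \<open>Point masses majorize everything, so the supremum is over a nonempty
    set.\<close>
  obtain k b where k: "k \<in> storage N'" "b \<in> B" using storage_nonempty[OF N(2)] B by blast
  have "return_pmf k \<in> prob_dists (storage N')" "return_pmf b \<in> prob_dists B"
    using k by (auto simp: prob_dists_def)
  moreover have "majorized X P (storage N') (return_pmf k)"
    using majorized_map[OF X(1) finite_storage, of "\<lambda>_. k" N' P] X k by simp
  moreover have "majorized (storage N') (return_pmf k) B (return_pmf b)"
    using majorized_map[OF finite_storage B(1), of "\<lambda>_. b" N' "return_pmf k"] k
    by (simp add: prob_dists_def)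
  ultimately show "{fidelity B P'' QB | P''. P'' \<in> prob_dists B \<and>
            (\<exists>P'\<in>prob_dists (storage N').
               majorized X P (storage N') P' \<and> majorized (storage N') P' B P'')} \<noteq> {}"
    by blast
next
  fix \<phi>
  assume "\<phi> \<in> {fidelity B P'' QB | P''. P'' \<in> prob_dists B \<and>
            (\<exists>P'\<in>prob_dists (storage N').
               majorized X P (storage N') P' \<and> majorized (storage N') P' B P'')}"
  then obtain R P' where \<phi>: "\<phi> = fidelity B R QB" and R: "R \<in> prob_dists B"
    and P': "P' \<in> prob_dists (storage N')"
    and maj: "majorized X P (storage N') P'" "majorized (storage N') P' B R"
    by blast
  have "card (set_pmf R) \<le> card (storage N')"
    using majorized_card_support[OF finite_storage P' B(1) R maj(2)] .
  then have "real (card (set_pmf R)) \<le> \<kappa>\<^sup>2 * real (card (storage N))" using card by linarith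
  then obtain f where f: "f \<in> X \<rightarrow> A" "card (f ` X) \<le> card (storage N)"
    "fidelity B R QB - \<kappa> * sqrt \<eta> - 2 * sqrt (K / \<kappa>) - 1 / K \<le> fidelity A (map_pmf f P) QA"
    using deterministic_from_majorized[OF X A B(1) R majorized_trans[OF maj] h QB w0 w\<eta> w1 _
        card_storage_bounds(1)[OF N(1)] \<kappa> K \<eta>] by metis
  obtain a where "a \<in> A" using A by blast
  then have "fidelity A (map_pmf f P) QA \<le> fid_det X P A QA N"
    using fidelity_le_fid_det[OF A(1) _ X f(1,2)] by blast
  then show "\<phi> \<le> fid_det X P A QA N + (\<kappa> * sqrt \<eta> + 2 * sqrt (K / \<kappa>) + 1 / K)"
    using f(3) \<phi> by linarith
qed

section \<open>Product distributions and their prefixes\<close>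

lemma finite_power_set [simp]: "finite Y \<Longrightarrow> finite (power_set Y n)"
  using finite_lists_length_eq[of Y n] by (simp add: power_set_def)

lemma replicate_pmf_prob_dists: "Q \<in> prob_dists Y \<Longrightarrow> replicate_pmf n Q \<in> prob_dists (power_set Y n)"
  by (auto simp: prob_dists_def power_set_def set_replicate_pmf lists_eq_set)

lemma pmf_replicate_Cons: "pmf (replicate_pmf (Suc n) Q) (x # xs) = pmf Q x * pmf (replicate_pmf n Q) xs"
proof -
  have "replicate_pmf (Suc n) Q = map_pmf (\<lambda>(x, xs). x # xs) (pair_pmf Q (replicate_pmf n Q))"
    by (simp add: pair_pmf_def map_bind_pmf bind_assoc_pmf bind_return_pmf map_pmf_def)
  moreover have "pmf \<dots> ((\<lambda>(x, xs). x # xs) (x, xs)) = pmf (pair_pmf Q (replicate_pmf n Q)) (x, xs)"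
    by (intro pmf_map_inj') (auto simp: inj_def)
  ultimately show ?thesis by (simp add: pmf_pair)
qed

lemma pmf_replicate_append:
  "length xs = m \<Longrightarrow> pmf (replicate_pmf (m + n) Q) (xs @ ys) = pmf (replicate_pmf m Q) xs * pmf (replicate_pmf n Q) ys"
  by (induction m arbitrary: xs) (auto simp: length_Suc_conv pmf_replicate_Cons simp del: replicate_pmf.simps(2))

lemma pmf_replicate_le:
  assumes "\<And>y. pmf Q y \<le> c" and "length ys = n"
  shows "pmf (replicate_pmf n Q) ys \<le> c ^ n"
  using assms(2)
proof (induction n arbitrary: ys)
  case (Suc n)
  have "0 \<le> c" using assms(1) pmf_nonneg order_trans by metis
  with Suc assms(1) show ?case
    by (auto simp: length_Suc_conv pmf_replicate_Cons simp del: replicate_pmf.simps(2) intro!: mult_mono)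
qed simp

text \<open>The projection keeps the first \<open>T\<close> letters; the weight within a fibre is
  the law of the remaining \<open>T' - T\<close> letters, whose atoms are at most
  \<open>c ^ (T' - T)\<close>.\<close>

lemma fid_maj_le_fid_det_power:
  fixes \<kappa> :: real
  assumes X: "finite X" "P \<in> prob_dists X" and Y: "finite Y" "Q \<in> prob_dists Y"
    and c: "\<And>y. pmf Q y \<le> c" and T: "T \<le> T'"
    and N: "0 \<le> N" "0 \<le> N'" and card: "card (storage N') \<le> \<kappa>\<^sup>2 * card (storage N)"
    and \<kappa>: "0 < \<kappa>" and K: "0 < K"
  shows "fid_maj X P (power_set Y T') (replicate_pmf T' Q) N'
    \<le> fid_det X P (power_set Y T) (replicate_pmf T Q) N
      + (\<kappa> * sqrt (c ^ (T' - T)) + 2 * sqrt (K / \<kappa>) + 1 / K)"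
proof (rule fid_maj_le_fid_det[OF X, where h = "take T" and w = "\<lambda>b. pmf (replicate_pmf (T' - T) Q) (drop T b)"])
  have split: "length (take T b) = T" "length (drop T b) = T' - T" if "b \<in> power_set Y T'" for b
    using that T by (auto simp: power_set_def)
  show "take T \<in> power_set Y T' \<rightarrow> power_set Y T"
    using T set_take_subset[of T] by (fastforce simp: power_set_def)
  show "pmf (replicate_pmf T' Q) b
      = pmf (replicate_pmf T Q) (take T b) * pmf (replicate_pmf (T' - T) Q) (drop T b)"
    if "b \<in> power_set Y T'" for b
    using pmf_replicate_append[OF split(1)[OF that], of "T' - T" Q "drop T b"] T by simp
  show "pmf (replicate_pmf (T' - T) Q) (drop T b) \<le> c ^ (T' - T)" if "b \<in> power_set Y T'" for b
    by (rule pmf_replicate_le[OF c split(2)[OF that]])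
  show "(\<Sum>b | b \<in> power_set Y T' \<and> take T b = y. pmf (replicate_pmf (T' - T) Q) (drop T b)) \<le> 1" for y
  proof -
    let ?S = "{b. b \<in> power_set Y T' \<and> take T b = y}"
    have "inj_on (drop T) ?S"
      by (rule inj_onI) (metis (mono_tags) append_take_drop_id mem_Collect_eq)
    then have "(\<Sum>b\<in>?S. pmf (replicate_pmf (T' - T) Q) (drop T b)) = sum (pmf (replicate_pmf (T' - T) Q)) (drop T ` ?S)"
      by (simp add: sum.reindex)
    also have "\<dots> \<le> 1" using Y by (intro sum_pmf_le_1) auto
    finally show ?thesis .
  qed
  have "0 \<le> c" using c pmf_nonneg order_trans by metis
  then show "0 \<le> c ^ (T' - T)" by simp
  show "power_set Y T \<noteq> {}" "power_set Y T' \<noteq> {}"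
    using carrier_nonempty replicate_pmf_prob_dists[OF Y(2)] by blast+
qed (use Y \<kappa> K N card in auto)

section \<open>Second-order asymptotics\<close>

lemma ereal_le_liminf_iff:
  fixes f :: "nat \<Rightarrow> real"
  shows "ereal \<nu> \<le> liminf (\<lambda>n. ereal (f n)) \<longleftrightarrow> (\<forall>\<epsilon>>0. \<forall>\<^sub>F n in sequentially. \<nu> - \<epsilon> < f n)"
proof
  assume L: "ereal \<nu> \<le> liminf (\<lambda>n. ereal (f n))"
  show "\<forall>\<epsilon>>0. \<forall>\<^sub>F n in sequentially. \<nu> - \<epsilon> < f n"
  proof (intro allI impI)
    fix \<epsilon> :: real assume "0 < \<epsilon>"
    then have "ereal (\<nu> - \<epsilon>) < ereal \<nu>" by simp
    then show "\<forall>\<^sub>F n in sequentially. \<nu> - \<epsilon> < f n"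
      using L unfolding le_Liminf_iff by fastforce
  qed
next
  assume R: "\<forall>\<epsilon>>0. \<forall>\<^sub>F n in sequentially. \<nu> - \<epsilon> < f n"
  show "ereal \<nu> \<le> liminf (\<lambda>n. ereal (f n))"
    unfolding le_Liminf_iff
  proof (intro allI impI)
    fix y assume y: "y < ereal \<nu>"
    then obtain z where z: "y < ereal z" "ereal z < ereal \<nu>"
      using ereal_dense2 by blast
    then have "\<forall>\<^sub>F n in sequentially. \<nu> - (\<nu> - z) < f n" using R[rule_format, of "\<nu> - z"] by simp
    then show "\<forall>\<^sub>F n in sequentially. y < ereal (f n)"
      by (rule eventually_mono) (use z in \<open>auto intro: less_trans\<close>)
  qed
qed

lemma smallo_sqrt_bound:
  assumes "f \<in> o(\<lambda>n. sqrt (real n))" and "0 < (\<epsilon> :: real)"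
  shows "\<forall>\<^sub>F n in sequentially. \<bar>f n\<bar> \<le> \<epsilon> * sqrt (real n)"
  using landau_o.smallD[OF assms] by simp

text \<open>Excludes, for large \<open>n\<close>, the empty storage of negative size and the
  truncation of negative exponents by \<open>nat\<close>.\<close>

lemma eventually_linear_sqrt_nonneg:
  assumes "0 < (a :: real)" and "(\<lambda>n. F n - (a * real n + b * sqrt (real n))) \<in> o(\<lambda>n. sqrt (real n))"
  shows "\<forall>\<^sub>F n in sequentially. 0 \<le> F n"
proof -
  \<comment> \<open>Lowering \<open>b\<close> by 1 absorbs the \<open>o(sqrt n)\<close>
    term.\<close>
  have "\<forall>\<^sub>F n in sequentially. 0 \<le> a * real n + (b - 1) * sqrt (real n)"
    using assms(1) by real_asymp
  with smallo_sqrt_bound[OF assms(2) zero_less_one] show ?thesis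
    by eventually_elim (auto simp: algebra_simps abs_le_iff)
qed

text \<open>An atom of mass 1 would make every term of the entropy vanish.\<close>

lemma pmf_bounded_away_from_1:
  assumes Y: "finite Y" "Q \<in> prob_dists Y" and H: "0 < shannon_entropy Y Q"
  obtains c where "0 < c" "c < 1" "\<And>y. pmf Q y \<le> c"
proof -
  have lt: "pmf Q y < 1" for y
  proof (rule ccontr)
    assume "\<not> pmf Q y < 1"
    then have y: "pmf Q y = 1" using pmf_le_1[of Q y] by simp
    have "pmf Q z * log 2 (pmf Q z) = 0" for z
    proof (cases "z = y")
      case False
      have "pmf Q y + pmf Q z \<le> 1"
        using sum_pmf_le_1[of "{y, z}" Q] False by simp
      then show ?thesis using y pmf_nonneg[of Q z] by simp
    qed (simp add: y)
    then show False using H unfolding shannon_entropy_def by (subst (asm) sum.neutral) auto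
  qed
  define c where "c = Max (pmf Q ` Y)"
  have ne: "Y \<noteq> {}" using carrier_nonempty Y by blast
  have le: "pmf Q y \<le> c" if "y \<in> Y" for y using that Y by (simp add: c_def)
  have "c \<in> pmf Q ` Y" unfolding c_def using Y ne by (intro Max_in) auto
  then have c1: "c < 1" using lt by auto
  obtain z where z: "z \<in> set_pmf Q" using set_pmf_not_empty[of Q] by blast
  then have "0 < pmf Q z" by (simp add: pmf_positive)
  moreover have "z \<in> Y" using z Y by (auto simp: prob_dists_def)
  ultimately have c0: "0 < c" using le by fastforce
  show thesis
  proof (rule that[OF c0 c1])
    fix y
    have "pmf Q y = 0" if "y \<notin> Y"
      using that Y(2) unfolding prob_dists_def set_pmf_iff by (auto simp: set_pmf_iff)
    then show "pmf Q y \<le> c" using le[of y] c0 by (cases "y \<in> Y") auto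
  qed
qed

lemma eventually_fid_det_le_fid_maj:
  assumes X: "finite X" "P \<in> prob_dists X" and Y: "finite Y" "Q \<in> prob_dists Y"
    and S: "\<forall>\<^sub>F n in sequentially. 0 \<le> S n"
  shows "\<forall>\<^sub>F n in sequentially.
    iid_fid fid_det X P Y Q n (T n) (S n) \<le> iid_fid fid_maj X P Y Q n (T n) (S n)"
  using S
proof eventually_elim
  case (elim n)
  have "power_set Y (nat (T n)) \<noteq> {}"
    using carrier_nonempty replicate_pmf_prob_dists[OF Y(2)] by blast
  with elim X Y show ?case
    unfolding iid_fid_def by (intro fid_det_le_fid_maj) (auto intro: replicate_pmf_prob_dists)
qed

text \<open>
  The surplus copies of \<open>Q\<close> have atoms of size \<open>exp (- \<Omega> (sqrt n))\<close>, which pays both for the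
  passage to a deterministic map and for the smaller storage.
\<close>

lemma eventually_fid_maj_le_fid_det:
  assumes X: "finite X" "P \<in> prob_dists X" and Y: "finite Y" "Q \<in> prob_dists Y"
    and H: "0 < shannon_entropy Y Q"
    and S: "\<forall>\<^sub>F n in sequentially. 0 \<le> S n" and S': "\<forall>\<^sub>F n in sequentially. 0 \<le> S' n"
    and SS': "(\<lambda>n. S' n - S n) \<in> o(\<lambda>n. sqrt (real n))"
    and T: "\<forall>\<^sub>F n in sequentially. 0 \<le> T n" and \<delta>: "0 < \<delta>"
    and TT': "\<forall>\<^sub>F n in sequentially. real_of_int (T n) + \<delta> * sqrt (real n) \<le> real_of_int (T' n)"
    and \<epsilon>: "0 < \<epsilon>"
  shows "\<forall>\<^sub>F n in sequentially.
    iid_fid fid_maj X P Y Q n (T' n) (S' n) \<le> iid_fid fid_det X P Y Q n (T n) (S n) + \<epsilon>"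
proof -
  obtain c where c: "0 < c" "c < 1" "\<And>y. pmf Q y \<le> c"
    using pmf_bounded_away_from_1[OF Y H] by blast
  \<comment> \<open>Chosen such that, with \<open>L = \<theta> * sqrt n\<close>, the surplus atoms
    satisfy \<open>sqrt (c ^ m) \<le> 2 powr (- 2 * L)\<close>.\<close>
  define \<theta> where "\<theta> = - \<delta> * log 2 c / 4"
  have \<theta>: "0 < \<theta>" using c \<delta> by (simp add: \<theta>_def mult_less_0_iff)
  define err where "err n = 2 powr (- \<theta> * sqrt (real n)) + 2 * 2 powr (- \<theta> * sqrt (real n) / 4)
     + 2 powr (- \<theta> * sqrt (real n) / 2)" for n
  have "err \<longlonglongrightarrow> 0" unfolding err_def using \<theta> by real_asymp
  then have "\<forall>\<^sub>F n in sequentially. err n < \<epsilon>" using \<epsilon> by (rule order_tendstoD(2))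
  moreover have "\<forall>\<^sub>F n in sequentially. 1 \<le> \<theta> * sqrt (real n)" using \<theta> by real_asymp
  ultimately show ?thesis
    using S S' T TT' smallo_sqrt_bound[OF SS' \<theta>]
  proof eventually_elim
    case (elim n)
    define L where "L = \<theta> * sqrt (real n)"
    define m where "m = nat (T' n) - nat (T n)"
    have "0 \<le> \<delta> * sqrt (real n)" using \<delta> by simp
    then have "T n \<le> T' n" using elim by linarith
    then have m: "\<delta> * sqrt (real n) \<le> real m" "nat (T n) \<le> nat (T' n)"
      using elim by (auto simp: m_def of_nat_diff)
    \<comment> \<open>\<open>\<kappa>\<close> spends half of the available exponent
      \<open>2 * L\<close>, and \<open>K\<close> lies between 1 and \<open>\<kappa>\<close>, so that
      all three errors decay: they are bounded by the terms of \<open>err\<close>.\<close>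
    define \<kappa> where "\<kappa> = (2::real) powr L"
    define K where "K = (2::real) powr (L / 2)"
    have 1: "\<kappa> * sqrt (c ^ m) \<le> 2 powr (- L)"
    proof -
      have "log 2 c * real m \<le> log 2 c * (\<delta> * sqrt (real n))"
        using c m by (intro mult_left_mono_neg) auto
      then have "log 2 c * real m / 2 \<le> - 2 * L" by (simp add: L_def \<theta>_def mult_ac)
      then have "2 powr (log 2 c * real m / 2) \<le> (2::real) powr (- 2 * L)" by simp
      moreover have "sqrt (c ^ m) = 2 powr (log 2 c * real m / 2)"
      proof -
        have "c ^ m = 2 powr (log 2 c * real m)"
          using c by (simp add: powr_powr[symmetric] powr_realpow)
        then show ?thesis by (simp add: powr_half_sqrt_powr)
      qed
      ultimately have "\<kappa> * sqrt (c ^ m) \<le> 2 powr L * 2 powr (- 2 * L)"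
        by (simp add: \<kappa>_def)
      then show ?thesis by (simp add: powr_add[symmetric])
    qed
    have 2: "sqrt (K / \<kappa>) = 2 powr (- L / 4)"
      by (simp add: K_def \<kappa>_def powr_diff[symmetric] powr_half_sqrt_powr[symmetric] field_simps)
    have 3: "1 / K = 2 powr (- L / 2)" by (simp add: K_def powr_minus_divide)
    \<comment> \<open>The storages differ by at most \<open>L\<close> bits, while the square of
      \<open>\<kappa>\<close> pays for \<open>2 * L\<close>. As \<open>L \<ge> 1\<close>, one bit is
      left for the rounding in \<open>storage (S n)\<close>.\<close>
    have "real (card (storage (S' n))) \<le> 2 powr S' n" using card_storage_bounds elim by simp
    also have "\<dots> \<le> 2 powr (2 * L + (S n - 1))"
      using elim by (intro powr_mono) (auto simp: L_def)
    also have "\<dots> = \<kappa>\<^sup>2 * (2 powr S n / 2)"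
      by (simp add: \<kappa>_def powr_add powr_diff powr_power)
    also have "\<dots> \<le> \<kappa>\<^sup>2 * card (storage (S n))"
      using card_storage_bounds elim by (intro mult_left_mono) auto
    finally have "fid_maj (power_set X n) (replicate_pmf n P) (power_set Y (nat (T' n))) (replicate_pmf (nat (T' n)) Q) (S' n)
      \<le> fid_det (power_set X n) (replicate_pmf n P) (power_set Y (nat (T n))) (replicate_pmf (nat (T n)) Q) (S n)
        + (\<kappa> * sqrt (c ^ m) + 2 * sqrt (K / \<kappa>) + 1 / K)"
      unfolding m_def using elim m(2)
      by (intro fid_maj_le_fid_det_power finite_power_set replicate_pmf_prob_dists X Y c(3))
        (simp_all add: \<kappa>_def K_def)
    moreover have "\<kappa> * sqrt (c ^ m) + 2 * sqrt (K / \<kappa>) + 1 / K < \<epsilon>"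
      using 1 2 3 elim by (simp add: err_def L_def)
    ultimately show ?case by (simp add: iid_fid_def)
  qed
qed

lemma floor_linear_sqrt_smallo:
  "(\<lambda>n. real_of_int \<lfloor>a * real n + b * sqrt (real n)\<rfloor> - (a * real n + b * sqrt (real n))) \<in> o(\<lambda>n. sqrt (real n))"
proof (rule landau_o.smallI)
  fix c :: real assume "0 < c"
  then have "\<forall>\<^sub>F n in sequentially. 1 \<le> c * sqrt (real n)" by real_asymp
  then show "\<forall>\<^sub>F n in sequentially. norm (real_of_int \<lfloor>a * real n + b * sqrt (real n)\<rfloor> - (a * real n + b * sqrt (real n)))
      \<le> c * norm (sqrt (real n))"
    by (rule eventually_mono) (use floor_correct in \<open>simp, linarith\<close>)
qed

theorem theorem22:
  fixes X :: "'a set" and Y :: "'b set" and P :: "'a pmf" and Q :: "'b pmf"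
    and s1 \<nu> :: real
  assumes "finite X" and "finite Y"
    and "P \<in> prob_dists X" and "Q \<in> prob_dists Y"
    and "shannon_entropy Y Q > 0"
    and "0 < s1" and "s1 \<le> shannon_entropy X P"
    and "0 < \<nu>" and "\<nu> < 1"
  shows "rate_region2 fid_det X P Y Q s1 (s1 / shannon_entropy Y Q) \<nu>
           = rate_region2 fid_maj X P Y Q s1 (s1 / shannon_entropy Y Q) \<nu>
       \<and> rate_region2 fid_maj X P Y Q s1 (s1 / shannon_entropy Y Q) \<nu>
           = {(s2, t2). ereal t2 \<le> lim_fid_inv X P Y Q s1 s2 \<nu>}"
proof -
  note X = assms(1,3) and Y = assms(2,4) and H = assms(5) and s1 = assms(6)
  define t1 where "t1 = s1 / shannon_entropy Y Q"
  have t1: "0 < t1" using H s1 by (simp add: t1_def)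
  define FD where "FD = iid_fid fid_det X P Y Q"
  define FM where "FM = iid_fid fid_maj X P Y Q"
  define S where "S s2 n = s1 * real n + s2 * sqrt (real n)" for s2 n
  define T where "T t n = \<lfloor>t1 * real n + t * sqrt (real n)\<rfloor>" for t n
  define G where "G s2 t n = FD n (T t n) (S s2 n)" for s2 t n
  have S0: "\<forall>\<^sub>F n in sequentially. 0 \<le> S s2 n" for s2
    using eventually_linear_sqrt_nonneg[OF s1, of "S s2" s2] by (simp add: S_def)
  have lim_G: "ereal \<nu> \<le> lim_fid fid_det X P Y Q s1 s2 t
      \<longleftrightarrow> (\<forall>\<epsilon>>0. \<forall>\<^sub>F n in sequentially. \<nu> - \<epsilon> < G s2 t n)" for s2 t
    unfolding lim_fid_def G_def T_def S_def FD_def t1_def by (rule ereal_le_liminf_iff)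

  \<comment> \<open>Any admissible sequences for majorization at \<open>t2\<close> can be replaced
    by the canonical ones for deterministic conversion at any smaller \<open>t\<close>.\<close>
  have compare: "\<forall>\<^sub>F n in sequentially. \<nu> - \<epsilon> < G s2 t n"
    if S': "(\<lambda>n. S' n - (s1 * real n + s2 * sqrt (real n))) \<in> o(\<lambda>n. sqrt (real n))"
      and T': "(\<lambda>n. real_of_int (T' n) - (t1 * real n + t2 * sqrt (real n))) \<in> o(\<lambda>n. sqrt (real n))"
      and FM: "\<forall>\<epsilon>>0. \<forall>\<^sub>F n in sequentially. \<nu> - \<epsilon> < FM n (T' n) (S' n)"
      and t: "t < t2" and \<epsilon>: "0 < \<epsilon>"
    for S' T' s2 t t2 \<epsilon>
  proof -
    \<comment> \<open>Half of the gap absorbs the \<open>o(sqrt n)\<close> deviation of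
      \<open>T'\<close>; the other half remains as surplus copies.\<close>
    define \<delta> where "\<delta> = (t2 - t) / 2"
    have \<delta>: "0 < \<delta>" using t by (simp add: \<delta>_def)
    have "\<forall>\<^sub>F n in sequentially. 0 \<le> real_of_int (T t n)"
      using eventually_linear_sqrt_nonneg[OF t1 floor_linear_sqrt_smallo] by (simp add: T_def)
    then have T0: "\<forall>\<^sub>F n in sequentially. 0 \<le> T t n" by simp
    have "\<forall>\<^sub>F n in sequentially. real_of_int (T t n) + \<delta> * sqrt (real n) \<le> real_of_int (T' n)"
      using smallo_sqrt_bound[OF T' \<delta>]
    proof eventually_elim
      case (elim n)
      have "real_of_int (T t n) \<le> t1 * real n + t * sqrt (real n)" by (simp add: T_def)
      moreover have "t2 * sqrt (real n) = t * sqrt (real n) + 2 * (\<delta> * sqrt (real n))"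
        by (simp add: \<delta>_def field_simps)
      ultimately show ?case using elim by linarith
    qed
    from eventually_fid_maj_le_fid_det[OF X Y H S0 eventually_linear_sqrt_nonneg[OF s1 S'] _ T0 \<delta> this half_gt_zero[OF \<epsilon>], of s2]
    have "\<forall>\<^sub>F n in sequentially. FM n (T' n) (S' n) \<le> G s2 t n + \<epsilon> / 2"
      using S' by (simp add: S_def G_def FM_def FD_def)
    moreover have "\<forall>\<^sub>F n in sequentially. \<nu> - \<epsilon> / 2 < FM n (T' n) (S' n)" using FM \<epsilon> by simp
    ultimately show ?thesis by eventually_elim simp
  qed

  have DM: "rate_region2 fid_det X P Y Q s1 t1 \<nu> \<subseteq> rate_region2 fid_maj X P Y Q s1 t1 \<nu>"
  proof clarify
    fix s2 t2 assume "(s2, t2) \<in> rate_region2 fid_det X P Y Q s1 t1 \<nu>"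
    then obtain S' T' where S': "(\<lambda>n. S' n - (s1 * real n + s2 * sqrt (real n))) \<in> o(\<lambda>n. sqrt (real n))"
      and T': "(\<lambda>n. real_of_int (T' n) - (t1 * real n + t2 * sqrt (real n))) \<in> o(\<lambda>n. sqrt (real n))"
      and L: "ereal \<nu> \<le> liminf (\<lambda>n. ereal (iid_fid fid_det X P Y Q n (T' n) (S' n)))"
      by (auto simp: rate_region2_def)
    have "liminf (\<lambda>n. ereal (iid_fid fid_det X P Y Q n (T' n) (S' n)))
        \<le> liminf (\<lambda>n. ereal (iid_fid fid_maj X P Y Q n (T' n) (S' n)))"
      using eventually_fid_det_le_fid_maj[OF X Y eventually_linear_sqrt_nonneg[OF s1 S'], of T']
      by (intro Liminf_mono) simp
    with L S' T' show "(s2, t2) \<in> rate_region2 fid_maj X P Y Q s1 t1 \<nu>"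
      by (auto simp: rate_region2_def intro: order_trans)
  qed

  have MI: "rate_region2 fid_maj X P Y Q s1 t1 \<nu> \<subseteq> {(s2, t2). ereal t2 \<le> lim_fid_inv X P Y Q s1 s2 \<nu>}"
  proof clarify
    fix s2 t2 assume "(s2, t2) \<in> rate_region2 fid_maj X P Y Q s1 t1 \<nu>"
    then obtain S' T' where S': "(\<lambda>n. S' n - (s1 * real n + s2 * sqrt (real n))) \<in> o(\<lambda>n. sqrt (real n))"
      and T': "(\<lambda>n. real_of_int (T' n) - (t1 * real n + t2 * sqrt (real n))) \<in> o(\<lambda>n. sqrt (real n))"
      and L: "ereal \<nu> \<le> liminf (\<lambda>n. ereal (FM n (T' n) (S' n)))"
      by (auto simp: rate_region2_def FM_def)
    note L' = L[unfolded ereal_le_liminf_iff]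
    have le: "ereal t \<le> lim_fid_inv X P Y Q s1 s2 \<nu>" if "t < t2" for t
      unfolding lim_fid_inv_def using compare[OF S' T' L' that] lim_G by (intro Sup_upper) simp
    show "ereal t2 \<le> lim_fid_inv X P Y Q s1 s2 \<nu>"
    \<comment> \<open>\<open>compare\<close> reaches only \<open>t < t2\<close>; the supremum closes
      the gap.\<close>
    proof (rule dense_le)
      fix y assume "y < ereal t2"
      then obtain z where "y < ereal z" "z < t2"
        using ereal_dense2 less_ereal.simps(1) by blast
      then show "y \<le> lim_fid_inv X P Y Q s1 s2 \<nu>" using le[of z] by (meson less_imp_le order_trans)
    qed
  qed

  have ID: "{(s2, t2). ereal t2 \<le> lim_fid_inv X P Y Q s1 s2 \<nu>} \<subseteq> rate_region2 fid_det X P Y Q s1 t1 \<nu>"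
  proof clarify
    fix s2 t2 assume t2: "ereal t2 \<le> lim_fid_inv X P Y Q s1 s2 \<nu>"
    define d where "d k = 1 / real (Suc k)" for k
    have d: "0 < d k" for k by (simp add: d_def)
    \<comment> \<open>The bound \<open>k \<le> n\<close> guarantees that a greatest good index
      exists whenever there is one.\<close>
    define good where "good n k \<longleftrightarrow> k \<le> n \<and> \<nu> - d k < G s2 (t2 - d k) n" for n k
    have good: "\<forall>\<^sub>F n in sequentially. good n k" for k
    proof -
      have "ereal (t2 - d k) < ereal t2" using d by simp
      then have "ereal (t2 - d k) < lim_fid_inv X P Y Q s1 s2 \<nu>" using t2 by (rule less_le_trans)
      then obtain t where t: "t2 - d k < t" and L: "ereal \<nu> \<le> lim_fid fid_det X P Y Q s1 s2 t"
        by (auto simp: lim_fid_inv_def less_Sup_iff)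
      \<comment> \<open>No monotonicity in \<open>t\<close> is at hand: the bound at
        \<open>t\<close> is passed to majorization and brought down by \<open>compare\<close> to the
        smaller \<open>t2 - d k\<close>.\<close>
      have FM: "\<forall>\<epsilon>>0. \<forall>\<^sub>F n in sequentially. \<nu> - \<epsilon> < FM n (T t n) (S s2 n)"
      proof (intro allI impI)
        fix \<epsilon> :: real assume "0 < \<epsilon>"
        then have "\<forall>\<^sub>F n in sequentially. \<nu> - \<epsilon> < FD n (T t n) (S s2 n)"
          using L lim_G by (simp add: G_def)
        with eventually_fid_det_le_fid_maj[OF X Y S0, of "T t" s2]
        show "\<forall>\<^sub>F n in sequentially. \<nu> - \<epsilon> < FM n (T t n) (S s2 n)"
          unfolding FM_def FD_def by eventually_elim simp
      qed
      have "\<forall>\<^sub>F n in sequentially. \<nu> - d k < G s2 (t2 - d k) n"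
        by (rule compare[OF _ _ FM t d]) (simp_all add: S_def T_def floor_linear_sqrt_smallo)
      moreover have "\<forall>\<^sub>F n in sequentially. k \<le> n" by (rule eventually_ge_at_top)
      ultimately show ?thesis unfolding good_def by eventually_elim simp
    qed
    \<comment> \<open>Diagonal choice: every fixed index is eventually good, so \<open>k n\<close>
      tends to infinity and \<open>d (k n)\<close> to 0.\<close>
    define k where "k n = (GREATEST i. good n i)" for n
    have k_ge: "\<forall>\<^sub>F n in sequentially. good n (k n) \<and> i \<le> k n" for i
      using good[of i]
    proof eventually_elim
      case (elim n)
      have "\<forall>j. good n j \<longrightarrow> j \<le> n" by (simp add: good_def)
      then show ?case unfolding k_def using elim GreatestI_nat Greatest_le_nat by metis
    qed
    have d_small: "\<forall>\<^sub>F n in sequentially. good n (k n) \<and> d (k n) < \<epsilon>" if \<epsilon>: "0 < \<epsilon>" for \<epsilon>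
    proof -
      obtain i where "1 / real (Suc i) < \<epsilon>" by (rule nat_approx_posE[OF \<epsilon>])
      then have i: "d i < \<epsilon>" by (simp add: d_def)
      show ?thesis using k_ge[of i]
      proof eventually_elim
        case (elim n)
        then have "d (k n) \<le> d i" by (simp add: d_def frac_le)
        then show ?case using elim i by simp
      qed
    qed
    define T' where "T' n = T (t2 - d (k n)) n" for n
    have "(\<lambda>n. real_of_int (T' n) - (t1 * real n + t2 * sqrt (real n))) \<in> o(\<lambda>n. sqrt (real n))"
    proof (rule landau_o.smallI)
      fix c :: real assume c: "0 < c"
      then have "\<forall>\<^sub>F n in sequentially. 1 \<le> c / 2 * sqrt (real n)" by real_asymp
      with d_small[OF half_gt_zero[OF c]]
      show "\<forall>\<^sub>F n in sequentially. norm (real_of_int (T' n) - (t1 * real n + t2 * sqrt (real n)))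
          \<le> c * norm (sqrt (real n))"
      proof eventually_elim
        case (elim n)
        have "d (k n) * sqrt (real n) \<le> c / 2 * sqrt (real n)"
          using elim by (intro mult_right_mono) auto
        moreover have "0 \<le> d (k n) * sqrt (real n)" using d[of "k n"] by simp
        moreover have "\<bar>real_of_int (T' n) - (t1 * real n + (t2 - d (k n)) * sqrt (real n))\<bar> \<le> 1"
          unfolding T'_def T_def by linarith
        ultimately show ?case using elim by (simp add: left_diff_distrib abs_le_iff)
      qed
    qed
    moreover have "ereal \<nu> \<le> liminf (\<lambda>n. ereal (FD n (T' n) (S s2 n)))"
      unfolding ereal_le_liminf_iff
    proof (intro allI impI)
      fix \<epsilon> :: real assume "0 < \<epsilon>"
      from d_small[OF this] show "\<forall>\<^sub>F n in sequentially. \<nu> - \<epsilon> < FD n (T' n) (S s2 n)"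
        by eventually_elim (auto simp: good_def G_def T'_def)
    qed
    moreover have "(\<lambda>n. S s2 n - (s1 * real n + s2 * sqrt (real n))) \<in> o(\<lambda>n. sqrt (real n))"
      by (simp add: S_def)
    ultimately show "(s2, t2) \<in> rate_region2 fid_det X P Y Q s1 t1 \<nu>"
      unfolding rate_region2_def FD_def by blast
  qed
  show ?thesis using DM MI ID unfolding t1_def[symmetric] by blast
qed

end
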